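(* Let $p,s,m$ and $n$ be integers such that $0<p<s$, $m\geq 0$ and $n=(2m+1)s$. Assume there exists a radial function $\phi$ such that $T_{e^{ip\theta}\phi}$ commutes with $T_{e^{-is\theta}r^n}$ (as operators on the harmonic Bergman space $L^2_h$). Then $p=1$ and (i) $\phi(r)=\sum_{j=0}^{m}c_j r^{2j-1}$, for some constants $c_0,\dots,c_m$, if $s\leq m+1$; (ii) $\phi\equiv 0$ if $s>m+1$.
   Context: Let $\mathbb{D}$ be the open unit disk in $\mathbb{C}$, with normalized Lebesgue area measure $dA=\frac{1}{\pi}r\,dr\,d\theta$, where $(r,\theta)$ are polar coordinates. The harmonic Bergman space $L^2_h$ is the closed subspace of $L^2(\mathbb{D},dA)$ consisting of all harmonic functions on $\mathbb{D}$ belonging to $L^2(\mathbb{D},dA)$. Let $R_z$ denote the reproducing kernel of $L^2_h$ at $z\in\mathbb{D}$. For $f\in L^1(\mathbb{D},dA)$, the Toeplitz operator $T_f$ with symbol $f$ is densely defined on $L^2_h$ by $(T_fu)(z)=\int_{\mathbb{D}}f(w)u(w)R_z(w)\,dA(w)$ for $u$ a harmonic polynomial in $z$ and $\bar z$ (a finite linear combination of $z^k,\bar z^k$, $k\ge 0$). If $f$ is bounded, then $T_fu=Q(fu)$, where $Q$ is the orthogonal projection of $L^2(\mathbb{D},dA)$ onto $L^2_h$. Standing assumption: all symbols considered belong to $L^1(\mathbb{D},dA)$ and are such that the Toeplitz operator so defined extends to a bounded operator on $L^2_h$; $T_f$ denotes this extension. A radial function $\phi$ on $\mathbb{D}$ is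 one depending only on $r=|z|$. For an integer $p$, $e^{ip\theta}\phi$ denotes the symbol $re^{i\theta}\mapsto e^{ip\theta}\phi(r)$; in particular $e^{-is\theta}r^n$ is the symbol $re^{i\theta}\mapsto e^{-is\theta}r^n$. Two bounded operators $S,T$ commute if $ST=TS$.
   Formalization: As printed, p=1 fails for φ≡0 (e.g. p=2, s=3, m=0, n=3), since the zero operator commutes with everything; here p=1 is claimed only when φ is not almost everywhere zero, while (i) and (ii) are claimed for all p, with equality almost everywhere. *)

theory Defs
  imports "HOL-Complex_Analysis.Complex_Analysis"
begin

abbreviation unit_disk :: "complex set" (\<open>\<DD>\<close>) where
  "\<DD> \<equiv> ball 0 1"

definition dA :: "complex measure" where
  "dA = density (lebesgue_on \<DD>) (\<lambda>_. ennreal (1 / pi))"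

text \<open>
  Complex-valued harmonic functions on an open set: twice continuously differentiable in the
  real sense, with vanishing Laplacian. Here \<open>ux\<close>, \<open>uy\<close> are the first
  and \<open>uxx\<close>, \<open>uxy\<close>, \<open>uyx\<close>, \<open>uyy\<close> the second partial derivatives.
\<close>

definition harmonic_on :: "complex set \<Rightarrow> (complex \<Rightarrow> complex) \<Rightarrow> bool" where
  "harmonic_on S u \<longleftrightarrow> open S \<and>
     (\<exists>ux uy uxx uxy uyx uyy.
        (\<forall>z\<in>S.
           (u has_derivative (\<lambda>h. of_real (Re h) * ux z + of_real (Im h) * uy z)) (at z) \<and>
           (ux has_derivative (\<lambda>h. of_real (Re h) * uxx z + of_real (Im h) * uxy z)) (at z) \<and>
           (uy has_derivative (\<lambda>h. of_real (Re h) * uyx z + of_real (Im h) * uyy z)) (at z)) \<and>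
        continuous_on S uxx \<and> continuous_on S uxy \<and>
        continuous_on S uyx \<and> continuous_on S uyy \<and>
        (\<forall>z\<in>S. uxx z + uyy z = 0))"

text \<open>
  Functions on the disk are extended by 0 to the whole plane, so that equality of elements of
  \<open>L2h\<close> is equality of HOL functions. Harmonic functions that agree almost everywhere on the
  disk agree there, so no quotient is needed.
\<close>

definition L2h :: "(complex \<Rightarrow> complex) set" where
  "L2h = {u. harmonic_on \<DD> u \<and> integrable dA (\<lambda>z. (cmod (u z))\<^sup>2) \<and> (\<forall>z. z \<notin> \<DD> \<longrightarrow> u z = 0)}"

definition L2_inner :: "(complex \<Rightarrow> complex) \<Rightarrow> (complex \<Rightarrow> complex) \<Rightarrow> complex" where
  "L2_inner u v = (\<integral>z. u z * cnj (v z) \<partial>dA)"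

definition L2_norm :: "(complex \<Rightarrow> complex) \<Rightarrow> real" where
  "L2_norm u = sqrt (\<integral>z. (cmod (u z))\<^sup>2 \<partial>dA)"

definition rep_kernel :: "complex \<Rightarrow> complex \<Rightarrow> complex" where
  "rep_kernel z = (THE R. R \<in> L2h \<and> (\<forall>u\<in>L2h. u z = L2_inner u R))"

definition harmonic_polys :: "(complex \<Rightarrow> complex) set" where
  "harmonic_polys =
     {u. \<exists>(N::nat) a b. u = (\<lambda>z. if z \<in> \<DD> then \<Sum>k\<le>N. a k * z ^ k + b k * cnj z ^ k else 0)}"

text \<open>
  The integral formula, used on \<open>harmonic_polys\<close> only. The kernel is not conjugated:
  it is real-valued, since \<open>L2h\<close> is closed under complex conjugation.
\<close>

definition toeplitz_integral :: "(complex \<Rightarrow> complex) \<Rightarrow> (complex \<Rightarrow> complex) \<Rightarrow> complex \<Rightarrow> complex" where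
  "toeplitz_integral f u z = (if z \<in> \<DD> then \<integral>w. f w * u w * rep_kernel z w \<partial>dA else 0)"

definition bounded_operator_L2h :: "((complex \<Rightarrow> complex) \<Rightarrow> complex \<Rightarrow> complex) \<Rightarrow> bool" where
  "bounded_operator_L2h T \<longleftrightarrow>
     (\<forall>u\<in>L2h. T u \<in> L2h) \<and>
     (\<forall>u\<in>L2h. \<forall>v\<in>L2h. T (\<lambda>z. u z + v z) = (\<lambda>z. T u z + T v z)) \<and>
     (\<forall>c. \<forall>u\<in>L2h. T (\<lambda>z. c * u z) = (\<lambda>z. c * T u z)) \<and>
     (\<exists>C. \<forall>u\<in>L2h. L2_norm (T u) \<le> C * L2_norm u)"

definition extends_toeplitz ::
    "(complex \<Rightarrow> complex) \<Rightarrow> ((complex \<Rightarrow> complex) \<Rightarrow> complex \<Rightarrow> complex) \<Rightarrow> bool" where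
  "extends_toeplitz f T \<longleftrightarrow>
     bounded_operator_L2h T \<and> (\<forall>u\<in>harmonic_polys. T u = toeplitz_integral f u)"

definition admissible_symbol :: "(complex \<Rightarrow> complex) \<Rightarrow> bool" where
  "admissible_symbol f \<longleftrightarrow> integrable dA f \<and> (\<exists>T. extends_toeplitz f T)"

text \<open>
  For an admissible symbol the values on \<open>L2h\<close> do not depend on the choice, because
  \<open>harmonic_polys\<close> is dense in \<open>L2h\<close>. Values outside \<open>L2h\<close> are meaningless.
\<close>

definition toeplitz :: "(complex \<Rightarrow> complex) \<Rightarrow> (complex \<Rightarrow> complex) \<Rightarrow> complex \<Rightarrow> complex" where
  "toeplitz f = (SOME T. extends_toeplitz f T)"

definition commute_on_L2h ::
    "((complex \<Rightarrow> complex) \<Rightarrow> complex \<Rightarrow> complex) \<Rightarrow> ((complex \<Rightarrow> complex) \<Rightarrow> complex \<Rightarrow> complex) \<Rightarrow> bool" where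
  "commute_on_L2h S T \<longleftrightarrow> (\<forall>u\<in>L2h. S (T u) = T (S u))"

text \<open>
  The symbol \<open>e\<^sup>i\<^sup>p\<^sup>\<theta> \<phi>(r)\<close>. A radial function is represented by its profile
  \<open>\<phi>\<close> on the radii; only the values on \<open>[0,1)\<close> matter.
\<close>

definition quasihomogeneous :: "int \<Rightarrow> (real \<Rightarrow> complex) \<Rightarrow> complex \<Rightarrow> complex" where
  "quasihomogeneous p \<phi> z = cis (of_int p * Arg z) * \<phi> (cmod z)"

end

theory Submission
  imports Defs
begin

text \<open>
  Only the symbol \<open>\<phi> = 0\<close> can commute, so all three conclusions hold. On the orthogonal basis
  \<open>r\<^bsup>|k|\<^esup> e\<^bsup>ik\<theta>\<^esup>\<close> a quasihomogeneous Toeplitz operator is a weighted shift whose weights are moments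
  of the profile. With \<open>G l = \<integral> \<phi>(|w|) |w|\<^bsup>p + 2l\<^esup> dA\<close>, commutation on the basis vectors of index \<open>l + s\<close>
  is a two-term recurrence between \<open>G l\<close> and \<open>G (l + s)\<close>. It forces \<open>G (q s)\<close> to be a constant \<open>C\<close>
  times \<open>H ((q s + 1) / s)\<close> for the rational function \<open>H t = \<Prod>\<^bsub>1 \<le> j \<le> m\<^esub> (t + c + j) / \<Prod>\<^bsub>0 \<le> j \<le> m\<^esub> (t + j)\<close>,
  \<open>c = p / s\<close>. By partial fractions these are the moments of a polynomial in \<open>|w|\<^bsup>2s\<^esup>\<close>, and since
  the moments of order \<open>2 s q\<close> determine a radial function, \<open>G l = C H ((l + 1) / s)\<close> for all \<open>l\<close>. Commutation
  on the constant function now says that \<open>(t + c) H t\<close>, times \<open>C\<close>, takes equal values at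
  \<open>t = 1 / s\<close> and \<open>t = 1 / s + 1 - c\<close>; as \<open>(t + c) H t\<close> is strictly decreasing, \<open>C = 0\<close>.
\<close>

text \<open>With t = (l + 1) / s and c = p / s the recurrence reads (t + c + 1) (t + m + 1) G(t + 1)
  = t (t + c + m + 1) G(t). The Gamma quotient Gamma(t) Gamma(t + c + m + 1) / (Gamma(t + c + 1)
  Gamma(t + m + 1)) solves it, and the choice n = (2 m + 1) s makes the shifts integral, so that the
  quotient collapses to the rational function H. The recurrence alone leaves a factor of period 1 in
  t undetermined: it links only indices that differ by s. This is why a profile with the right
  moments along one progression is exhibited and compared with phi. The final contradiction comes
  from the absolute values in the exponents |k|: indices from s on stay nonnegative, whereas the
  constant function is carried to negative ones. Polar coordinates are avoided. Invariance of
  \<open>dA\<close> under rotations replaces the angular integral, and the uniform distribution of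
  |w|^2 on [0, 1] replaces the radial one. As \<open>rep_kernel\<close> is given by a description
  operator, the kernel has to be identified before any weight can be computed.\<close>

section \<open>Rotation invariance of Lebesgue measure in the plane\<close>

text \<open>The uniqueness argument for Haar measure: the double integral of 1_B(x) 1_A(x + y), with
  B the unit ball, is evaluated in both orders. Invariance of M gives |B| M(A); substituting x - y
  for x in the Lebesgue integral gives M(B) |A|. As |B| is positive and finite, it can be
  cancelled.\<close>

lemma translation_invariant_eq_lborel:
  fixes M :: "'a::euclidean_space measure"
  assumes sM: "sets M = sets borel" and sf: "sigma_finite_measure M"
    and tr: "\<And>a. distr M borel (\<lambda>x. x + a) = M"
    and B1: "emeasure M (ball 0 1) = emeasure lborel (ball (0::'a) 1)"
  shows "M = lborel"
proof (rule measure_eqI)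
  show "sets M = sets lborel" using sM by simp
next
  fix A assume "A \<in> sets M"
  then have A[measurable]: "A \<in> sets borel" using sM by simp
  interpret pair_sigma_finite lborel M
    by (simp add: pair_sigma_finite_def sf lborel.sigma_finite_measure_axioms)
  let ?B = "ball (0::'a) 1"
  have mM[measurable_cong]: "sets M = sets borel" by fact
  have eM: "(\<integral>\<^sup>+y. f y \<partial>M) = (\<integral>\<^sup>+y. f (y + a) \<partial>M)"
    if [measurable]: "f \<in> borel_measurable borel" for f :: "'a \<Rightarrow> ennreal" and a
  proof -
    have "(\<integral>\<^sup>+y. f y \<partial>M) = (\<integral>\<^sup>+y. f y \<partial>distr M borel (\<lambda>x. x + a))" by (simp add: tr)
    also have "\<dots> = (\<integral>\<^sup>+y. f (y + a) \<partial>M)" by (subst nn_integral_distr) auto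
    finally show ?thesis .
  qed
  have eL: "(\<integral>\<^sup>+y. f y \<partial>lborel) = (\<integral>\<^sup>+y. f (y + a) \<partial>lborel)"
    if [measurable]: "f \<in> borel_measurable borel" for f :: "'a \<Rightarrow> ennreal" and a
  proof -
    have "(\<integral>\<^sup>+y. f y \<partial>lborel) = (\<integral>\<^sup>+y. f y \<partial>distr lborel borel ((+) a))"
      by (simp add: lborel_distr_plus)
    also have "\<dots> = (\<integral>\<^sup>+y. f (y + a) \<partial>lborel)" by (subst nn_integral_distr) (auto simp: add.commute)
    finally show ?thesis .
  qed
  have sp: "sets (lborel \<Otimes>\<^sub>M M) = sets (borel :: ('a \<times> 'a) measure)"
    by (metis borel_prod mM sets_lborel sets_pair_measure_cong)
  have [measurable]: "(\<lambda>z::'a\<times>'a. fst z) \<in> borel \<rightarrow>\<^sub>M borel"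
      "(\<lambda>z::'a\<times>'a. fst z + snd z) \<in> borel \<rightarrow>\<^sub>M borel"
      "(\<lambda>z::'a\<times>'a. fst z - snd z) \<in> borel \<rightarrow>\<^sub>M borel"
    by (auto intro!: borel_measurable_continuous_onI continuous_intros)
  have [measurable]: "?B \<in> sets borel" by simp
  have iB[measurable]: "(indicator ?B :: 'a \<Rightarrow> ennreal) \<in> borel_measurable borel" by simp
  have m1: "(\<lambda>p. indicator ?B (fst p) * indicator A (fst p + snd p) :: ennreal) \<in> borel_measurable borel"
    "(\<lambda>p. indicator ?B (fst p - snd p) * indicator A (fst p) :: ennreal) \<in> borel_measurable borel"
    by (rule borel_measurable_times_ennreal;
        rule measurable_compose[OF _ borel_measurable_indicator]; measurable)+
  have "emeasure lborel ?B * emeasure M A = (\<integral>\<^sup>+x. indicator ?B x * emeasure M A \<partial>lborel)"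
    by (subst nn_integral_multc) (auto intro!: borel_measurable_indicator)
  also have "\<dots> = (\<integral>\<^sup>+x. (\<integral>\<^sup>+y. indicator ?B x * indicator A (x + y) \<partial>M) \<partial>lborel)"
  proof (rule nn_integral_cong)
    fix x :: 'a
    have "emeasure M A = (\<integral>\<^sup>+y. indicator A y \<partial>M)" by simp
    also have "\<dots> = (\<integral>\<^sup>+y. indicator A (x + y) \<partial>M)"
      using eM[of "indicator A" x] by (simp add: add.commute)
    finally show "indicator ?B x * emeasure M A = (\<integral>\<^sup>+y. indicator ?B x * indicator A (x + y) \<partial>M)"
      by (simp add: nn_integral_cmult)
  qed
  also have "\<dots> = (\<integral>\<^sup>+y. (\<integral>\<^sup>+x. indicator ?B x * indicator A (x + y) \<partial>lborel) \<partial>M)"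
    using Fubini'[of "\<lambda>x y. indicator ?B x * indicator A (x + y)"]
    using m1 by (simp add: case_prod_unfold measurable_cong_sets[OF sp refl])
  also have "\<dots> = (\<integral>\<^sup>+y. (\<integral>\<^sup>+x. indicator ?B (x - y) * indicator A x \<partial>lborel) \<partial>M)"
  proof (rule nn_integral_cong)
    fix y :: 'a
    have [measurable]: "(\<lambda>x. x - y) \<in> borel \<rightarrow>\<^sub>M borel" by measurable
    have m: "(\<lambda>x. indicator ?B (x - y) * indicator A x :: ennreal) \<in> borel_measurable borel"
      by (intro borel_measurable_times_ennreal measurable_compose[OF _ borel_measurable_indicator, of _ _ borel])
        measurable
    show "(\<integral>\<^sup>+x. indicator ?B x * indicator A (x + y) \<partial>lborel) =
        (\<integral>\<^sup>+x. indicator ?B (x - y) * indicator A x \<partial>lborel)"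
      using eL[OF m, of y] by simp
  qed
  also have "\<dots> = (\<integral>\<^sup>+x. (\<integral>\<^sup>+y. indicator ?B (x - y) * indicator A x \<partial>M) \<partial>lborel)"
    using Fubini'[of "\<lambda>x y. indicator ?B (x - y) * indicator A x"]
    using m1 by (simp add: case_prod_unfold measurable_cong_sets[OF sp refl])
  also have "\<dots> = (\<integral>\<^sup>+x. emeasure M ?B * indicator A x \<partial>lborel)"
  proof (rule nn_integral_cong)
    fix x :: 'a
    have "emeasure M ?B = (\<integral>\<^sup>+y. indicator ?B y \<partial>M)" by simp
    also have "\<dots> = (\<integral>\<^sup>+y. indicator ?B (y - x) \<partial>M)"
      using eM[of "indicator ?B" "-x"] by simp
    \<comment> \<open>The ball is symmetric about 0, so the sign of y - x can be flipped without
      knowing that M is invariant under reflection.\<close>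
    also have "\<dots> = (\<integral>\<^sup>+y. indicator ?B (x - y) \<partial>M)"
      by (intro nn_integral_cong) (auto simp: indicator_def dist_norm norm_minus_commute)
    finally show "(\<integral>\<^sup>+y. indicator ?B (x - y) * indicator A x \<partial>M) = emeasure M ?B * indicator A x"
      by (simp add: nn_integral_multc)
  qed
  also have "\<dots> = emeasure M ?B * emeasure lborel A" by (simp add: nn_integral_cmult)
  finally have eq: "emeasure lborel ?B * emeasure M A = emeasure lborel ?B * emeasure lborel A"
    using B1 by simp
  have fin: "emeasure lborel ?B \<noteq> \<infinity>" using emeasure_lborel_ball_finite[of "0::'a" 1] by auto
  have pos: "emeasure lborel ?B \<noteq> 0"
    by (simp add: emeasure_ball unit_ball_vol_pos ennreal_eq_0_iff less_imp_neq not_le)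
  show "emeasure M A = emeasure lborel A"
    using eq fin pos by (simp add: ennreal_mult_cancel_left)
qed

text \<open>Shifting by a after the rotation is the same as shifting by a / \<zeta> before it, so
  the rotated measure is again translation invariant. Balls about 0 are mapped to themselves, which
  gives the normalization and the sigma-finiteness.\<close>

lemma distr_lborel_rotate:
  fixes \<zeta> :: complex assumes z: "cmod \<zeta> = 1"
  shows "distr lborel borel ((*) \<zeta>) = lborel"
proof (rule translation_invariant_eq_lborel)
  have z0: "\<zeta> \<noteq> 0" using z by auto
  have [measurable]: "(*) \<zeta> \<in> borel \<rightarrow>\<^sub>M borel" by measurable
  show "sets (distr lborel borel ((*) \<zeta>)) = sets borel" by simp
  show tr: "distr (distr lborel borel ((*) \<zeta>)) borel (\<lambda>x. x + a) = distr lborel borel ((*) \<zeta>)" for a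
  proof -
    have "distr (distr lborel borel ((*) \<zeta>)) borel (\<lambda>x. x + a) 
        = distr lborel borel ((\<lambda>x. x + a) \<circ> (*) \<zeta>)"
      by (subst distr_distr) auto
    also have "(\<lambda>x. x + a) \<circ> (*) \<zeta> = (*) \<zeta> \<circ> (+) (a / \<zeta>)"
      using z0 by (auto simp: fun_eq_iff field_simps)
    also have "distr lborel borel \<dots> = distr (distr lborel borel ((+) (a/\<zeta>))) borel ((*) \<zeta>)"
      by (subst distr_distr) auto
    also have "\<dots> = distr lborel borel ((*) \<zeta>)" by (simp add: lborel_distr_plus)
    finally show ?thesis .
  qed
  have vb: "(*) \<zeta> -` ball 0 r = ball 0 r" for r
    using z by (auto simp: norm_mult)
  show "emeasure (distr lborel borel ((*) \<zeta>)) (ball 0 1) = emeasure lborel (ball (0::complex) 1)"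
    using vb[of 1] by (subst emeasure_distr) auto
  show "sigma_finite_measure (distr lborel borel ((*) \<zeta>))"
  proof (rule sigma_finite_measure.intro, intro exI conjI)
    show "countable (range (\<lambda>n::nat. ball (0::complex) (real n)))" by simp
    show "range (\<lambda>n::nat. ball (0::complex) (real n)) \<subseteq> sets (distr lborel borel ((*) \<zeta>))" by auto
    show "\<Union> (range (\<lambda>n::nat. ball (0::complex) (real n))) = space (distr lborel borel ((*) \<zeta>))"
      using reals_Archimedean2 by auto
    show "\<forall>a\<in>range (\<lambda>n. ball 0 (real n)). emeasure (distr lborel borel ((*) \<zeta>)) a \<noteq> \<infinity>"
      using emeasure_lborel_ball_finite by (auto simp: emeasure_distr vb less_top[symmetric])
  qed
qed

text \<open>The image of \<open>lborel\<close> under the rotation is \<open>lborel\<close> itself,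
  so preimages of null sets are null and both facts pass to the completion.\<close>

lemma
  fixes \<zeta> :: complex assumes z: "cmod \<zeta> = 1"
  shows measurable_lebesgue_rotate: "(*) \<zeta> \<in> lebesgue \<rightarrow>\<^sub>M lebesgue"
    and distr_lebesgue_rotate: "distr lebesgue lebesgue ((*) \<zeta>) = lebesgue"
proof -
  have m: "(*) \<zeta> \<in> borel \<rightarrow>\<^sub>M borel" by measurable
  have m': "(*) \<zeta> \<in> lebesgue \<rightarrow>\<^sub>M lborel"
    using measurable_completion[of "(*) \<zeta>" lborel lborel] m by simp
  have e: "distr lebesgue lborel ((*) \<zeta>) = lborel"
    using distr_completion[of "(*) \<zeta>" lborel lborel] m distr_lborel_rotate[OF z] 
    by (simp cong: distr_cong)
  show "(*) \<zeta> \<in> lebesgue \<rightarrow>\<^sub>M lebesgue"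
    using completion.measurable_completion2[OF m'] e by simp
  show "distr lebesgue lebesgue ((*) \<zeta>) = lebesgue"
    using completion.completion_distr_eq[OF m'] e by simp
qed

section \<open>The normalized area measure on the disk\<close>

lemma space_dA [simp]: "space dA = \<DD>" by (simp add: dA_def)

lemma sets_dA [measurable_cong]: "sets dA = sets (lebesgue_on \<DD>)" by (simp add: dA_def)

lemma emeasure_dA: "A \<in> sets dA \<Longrightarrow> emeasure dA A = ennreal (1 / pi) * emeasure lebesgue A"
  by (auto simp: dA_def emeasure_density_const emeasure_restrict_space sets_restrict_space)

lemma sets_dA_iff: "A \<in> sets dA \<longleftrightarrow> A \<subseteq> \<DD> \<and> A \<in> sets lebesgue"
  by (simp add: sets_dA sets_restrict_space_iff)

lemma emeasure_lborel_disk_ball: "r \<ge> 0 \<Longrightarrow> emeasure lborel (ball (0::complex) r) = ennreal (pi * r\<^sup>2)"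
  by (simp add: emeasure_ball unit_ball_vol_2)

lemma emeasure_dA_ball: assumes "0 \<le> r" "r \<le> 1" shows "emeasure dA (ball 0 r) = ennreal (r\<^sup>2)"
  using assms
  by (subst emeasure_dA) (auto simp: sets_dA_iff emeasure_lborel_disk_ball ennreal_mult'[symmetric])

lemma finite_measure_dA: "finite_measure dA"
  using emeasure_dA_ball[of 1] by (intro finite_measureI) simp

lemma measure_dA_disk: "measure dA \<DD> = 1"
  using emeasure_dA_ball[of 1] by (simp add: measure_def)

lemma borel_measurable_dA_continuous:
  fixes f :: "complex \<Rightarrow> 'b::topological_space"
  assumes "continuous_on \<DD> f" shows "f \<in> borel_measurable dA"
proof -
  have "f \<in> borel_measurable (restrict_space borel \<DD>)"
    by (rule borel_measurable_continuous_on_restrict) fact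
  then have "f \<in> borel_measurable (lebesgue_on \<DD>)"
    by (auto simp: measurable_def sets_restrict_space space_restrict_space) 
  then show ?thesis by (simp cong: measurable_cong_sets add: sets_dA)
qed

lemma integrable_dA_bounded:
  fixes f :: "complex \<Rightarrow> 'b::{banach,second_countable_topology}"
  assumes "f \<in> borel_measurable dA" "\<And>z. z \<in> \<DD> \<Longrightarrow> norm (f z) \<le> B"
  shows "integrable dA f"
  using assms by (intro finite_measure.integrable_const_bound[OF finite_measure_dA, of _ B]) auto

lemma distr_dA_rotate:
  assumes z: "cmod \<zeta> = 1"
  shows "distr dA dA ((*) \<zeta>) = dA" "(*) \<zeta> \<in> dA \<rightarrow>\<^sub>M dA"
proof -
  have vb: "(*) \<zeta> -` \<DD> = \<DD>" using z by (auto simp: norm_mult)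
  show m: "(*) \<zeta> \<in> dA \<rightarrow>\<^sub>M dA"
  proof (rule measurableI)
    fix A assume A: "A \<in> sets dA"
    then have "(*) \<zeta> -` A \<in> sets lebesgue"
      using measurable_sets[OF measurable_lebesgue_rotate[OF z], of A] by (simp add: sets_dA_iff)
    then show "(*) \<zeta> -` A \<inter> space dA \<in> sets dA" by (auto simp: sets_dA_iff)
  qed (use z in \<open>auto simp: norm_mult\<close>)
  show "distr dA dA ((*) \<zeta>) = dA"
  proof (rule measure_eqI)
    fix A assume "A \<in> sets (distr dA dA ((*) \<zeta>))"
    then have A: "A \<in> sets dA" by simp
    then have A': "A \<subseteq> \<DD>" "A \<in> sets lebesgue" by (auto simp: sets_dA_iff)
    have "(*) \<zeta> -` A \<subseteq> \<DD>" using A' vb by blast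
    then have "emeasure (distr dA dA ((*) \<zeta>)) A = emeasure dA ((*) \<zeta> -` A)"
      using A m by (subst emeasure_distr) (auto simp: Int_absorb2)
    also have "\<dots> = ennreal (1/pi) * emeasure lebesgue ((*) \<zeta> -` A)"
      using measurable_sets[OF m A] \<open>(*) \<zeta> -` A \<subseteq> \<DD>\<close> by (intro emeasure_dA) (simp add: Int_absorb2)
    also have "emeasure lebesgue ((*) \<zeta> -` A) = emeasure (distr lebesgue lebesgue ((*) \<zeta>)) A"
      using A' measurable_lebesgue_rotate[OF z] by (simp add: emeasure_distr)
    also have "\<dots> = emeasure lebesgue A" by (simp add: distr_lebesgue_rotate[OF z])
    finally show "emeasure (distr dA dA ((*) \<zeta>)) A = emeasure dA A"
      using A by (simp add: emeasure_dA)
  qed simp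
qed

lemma integral_dA_rotate:
  fixes f :: "complex \<Rightarrow> complex"
  assumes z: "cmod \<zeta> = 1" and f: "f \<in> borel_measurable dA"
  shows "(\<integral>w. f (\<zeta> * w) \<partial>dA) = (\<integral>w. f w \<partial>dA)"
  using integral_distr[OF distr_dA_rotate(2)[OF z] f] by (simp add: distr_dA_rotate(1)[OF z])

text \<open>Orthogonality of different angular modes: the rotation by the angle pi / k preserves the
  measure and changes the sign of the integrand, so the integral equals its own negative.\<close>

lemma integral_dA_homogeneous_eq_0:
  fixes f :: "complex \<Rightarrow> complex" and k :: int
  assumes f: "f \<in> borel_measurable dA" and k: "k \<noteq> 0"
    and h: "\<And>\<zeta> w. cmod \<zeta> = 1 \<Longrightarrow> w \<in> \<DD> \<Longrightarrow> f (\<zeta> * w) = \<zeta> powi k * f w"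
  shows "(\<integral>w. f w \<partial>dA) = 0"
proof -
  define \<zeta> where "\<zeta> = cis (pi / k)"
  have \<zeta>: "cmod \<zeta> = 1" "\<zeta> powi k = -1" using k by (auto simp: \<zeta>_def cis_power_int)
  have "(\<integral>w. f w \<partial>dA) = (\<integral>w. f (\<zeta> * w) \<partial>dA)" by (rule integral_dA_rotate[symmetric]) fact+
  also have "\<dots> = (\<integral>w. - f w \<partial>dA)"
    by (rule Bochner_Integration.integral_cong) (use h \<zeta> in auto)
  also have "\<dots> = - (\<integral>w. f w \<partial>dA)" by simp
  finally show ?thesis by simp
qed

text \<open>The disk of radius r has \<open>dA\<close>-measure r^2, hence |w|^2 is uniformly
  distributed on [0, 1]. Comparing the measures of the half-lines above x suffices.\<close>

lemma distr_dA_cmod_square: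
  "distr dA borel (\<lambda>w. (cmod w)\<^sup>2) = density lborel (indicator {0..1::real})" (is "?M = ?N")
proof (rule measure_eqI_lessThan)
  have m: "(\<lambda>w. (cmod w)\<^sup>2) \<in> borel_measurable dA"
    by (intro borel_measurable_dA_continuous continuous_intros)
  fix x :: real
  have 1: "emeasure ?M {x<..} = ennreal (if x < 0 then 1 else if x < 1 then 1 - x else 0)"
  proof -
    have "emeasure ?M {x<..} = emeasure dA {w\<in>\<DD>. x < (cmod w)\<^sup>2}"
      using m by (auto simp: emeasure_distr intro!: arg_cong[where f="emeasure dA"])
    also have "\<dots> = ennreal (if x < 0 then 1 else if x < 1 then 1 - x else 0)"
    proof (cases "0 \<le> x \<and> x < 1")
      case True
      define r where "r = sqrt x"
      have r: "0 \<le> r" "r < 1" "x = r\<^sup>2" using True by (auto simp: r_def real_sqrt_less_iff[of _ 1, simplified])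
      have "{w\<in>\<DD>. x < (cmod w)\<^sup>2} = \<DD> - cball 0 r"
        using r by (auto simp: abs_le_square_iff[symmetric] not_le[symmetric])
      moreover have "cball 0 r \<in> sets dA" using r by (auto simp: sets_dA_iff)
      moreover have "emeasure dA (cball 0 r) = ennreal (r\<^sup>2)"
        using r by (subst emeasure_dA)
          (auto simp: sets_dA_iff emeasure_cball unit_ball_vol_2 ennreal_mult'[symmetric])
      ultimately have "emeasure dA {w\<in>\<DD>. x < (cmod w)\<^sup>2} = ennreal 1 - ennreal (r\<^sup>2)"
        using emeasure_dA_ball[of 1] r
        by (simp, subst emeasure_Diff) (auto simp: sets_dA_iff)
      then show ?thesis using True r by (simp add: ennreal_minus[symmetric])
    next
      case False
      then consider "x < 0" | "x \<ge> 1" by linarith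
      then show ?thesis
      proof cases
        case 1
        then have "{w\<in>\<DD>. x < (cmod w)\<^sup>2} = \<DD>" by (auto intro: less_le_trans)
        then show ?thesis using 1 emeasure_dA_ball[of 1] by simp
      next
        case 2
        then have "{w\<in>\<DD>. x < (cmod w)\<^sup>2} = {}"
          by (auto simp: not_less) (smt (verit) norm_ge_zero power_le_one)
        then have e: "emeasure dA {w\<in>\<DD>. x < (cmod w)\<^sup>2} = 0" by (simp only: emeasure_empty)
        show ?thesis unfolding e using 2 by simp
      qed
    qed
    finally show ?thesis .
  qed
  have 2: "emeasure ?N {x<..} = ennreal (if x < 0 then 1 else if x < 1 then 1 - x else 0)"
  proof -
    have "emeasure ?N {x<..} = emeasure lborel ({0..1} \<inter> {x<..})"
      by (simp add: emeasure_density indicator_inter_arith[symmetric])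
    also have "{0..1} \<inter> {x<..} = (if x < 0 then {0..1} else {x<..1})" by auto
    also have "emeasure lborel \<dots> = ennreal (if x < 0 then 1 else if x < 1 then 1 - x else 0)"
      by (cases "x \<le> 1") auto
    finally show ?thesis .
  qed
  show "emeasure ?M {x<..} < \<infinity>" unfolding 1 by simp
  show "emeasure ?M {x<..} = emeasure ?N {x<..}" unfolding 1 2 ..
qed simp_all

lemma integral_dA_cmod_power: "(\<integral>w. complex_of_real (cmod w ^ (2 * j)) \<partial>dA) = 1 / of_nat (j + 1)"
proof -
  have m: "(\<lambda>w. (cmod w)\<^sup>2) \<in> borel_measurable dA"
    by (intro borel_measurable_dA_continuous continuous_intros)
  have "(\<integral>w. cmod w ^ (2 * j) \<partial>dA) = (\<integral>t. t ^ j \<partial>distr dA borel (\<lambda>w. (cmod w)\<^sup>2))"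
    using m by (subst integral_distr) (auto simp: power_mult)
  also have "\<dots> = (\<integral>t. t ^ j * indicator {0..1} t \<partial>lborel)"
    unfolding distr_dA_cmod_square
    using integral_density[of "\<lambda>t::real. t ^ j" lborel "indicator {0..1}"]
    by (simp add: mult.commute ennreal_indicator)
  also have "\<dots> = 1 / (j + 1)" by (subst integral_power) auto
  finally show ?thesis by (subst integral_complex_of_real) simp
qed

section \<open>Integration against the harmonic reproducing kernel\<close>

text \<open>Termwise integration of 1 / (1 - x)^2 = sum of (i + 1) x^i at x = z a(w). The i-th term
  is at most (i + 1) |z|^i |f|, which is summable after integration because |z| < 1.\<close>

lemma sums_integral_dA_power:
  fixes f a :: "complex \<Rightarrow> complex"
  assumes f: "integrable dA f" and a: "continuous_on \<DD> a" "\<And>w. w \<in> \<DD> \<Longrightarrow> cmod (a w) \<le> 1"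
    and z: "cmod z < 1"
  shows "(\<lambda>i. of_nat (Suc i) * z ^ i * (\<integral>w. f w * a w ^ i \<partial>dA)) sums (\<integral>w. f w * (1 / (1 - z * a w)\<^sup>2) \<partial>dA)"
proof -
  define g where "g i w = of_nat (Suc i) * z ^ i * (f w * a w ^ i)" for i w
  have sN: "summable (\<lambda>i. real (Suc i) * cmod z ^ i)"
    using geometric_deriv_sums[of "cmod z"] z by (auto simp: sums_iff)
  have ma: "(\<lambda>w. a w ^ i) \<in> borel_measurable dA" for i
    by (intro borel_measurable_dA_continuous continuous_intros a)
  have mf[measurable]: "f \<in> borel_measurable dA" using f by simp
  have ai: "cmod (a w ^ i) \<le> 1" if "w \<in> \<DD>" for w i
    using a(2)[OF that] by (simp add: norm_power power_le_one)
  have fa: "integrable dA (\<lambda>w. f w * a w ^ i)" for i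
    by (rule Bochner_Integration.integrable_bound[OF f])
      (use ma ai mf in \<open>auto simp: norm_mult intro!: mult_left_le AE_I2\<close>)
  then have ig: "integrable dA (g i)" for i by (simp add: g_def[abs_def])
  have ng: "norm (g i w) \<le> real (Suc i) * cmod z ^ i * cmod (f w)" if "w \<in> \<DD>" for i w
    using ai[OF that, of i]
    by (auto simp: g_def norm_mult norm_power intro!: mult_left_mono mult_left_le simp del: of_nat_Suc)
  have "(\<lambda>i. integral\<^sup>L dA (g i)) sums (\<integral>w. (\<Sum>i. g i w) \<partial>dA)"
  proof (rule sums_integral)
    show "integrable dA (g i)" for i by fact
    show "AE w in dA. summable (\<lambda>i. norm (g i w))"
    proof (rule AE_I2)
      fix w assume "w \<in> space dA"
      then have w: "w \<in> \<DD>" by simp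
      show "summable (\<lambda>i. norm (g i w))"
        by (rule summable_comparison_test'[OF summable_mult2[OF sN, of "cmod (f w)"]]) (use ng[OF w] in auto)
    qed
    show "summable (\<lambda>i. \<integral>w. norm (g i w) \<partial>dA)"
    proof (rule summable_comparison_test'[OF summable_mult2[OF sN, of "\<integral>w. cmod (f w) \<partial>dA"]])
      fix i :: nat
      have "(\<integral>w. norm (g i w) \<partial>dA) \<le> (\<integral>w. real (Suc i) * cmod z ^ i * cmod (f w) \<partial>dA)"
        by (rule integral_mono) (use ng ig f in \<open>auto simp del: of_nat_Suc\<close>)
      then show "norm (\<integral>w. norm (g i w) \<partial>dA) \<le> real (Suc i) * cmod z ^ i * (\<integral>w. cmod (f w) \<partial>dA)"
        by simp
    qed
  qed
  also have "(\<integral>w. (\<Sum>i. g i w) \<partial>dA) = (\<integral>w. f w * (1 / (1 - z * a w)\<^sup>2) \<partial>dA)"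
  proof (rule Bochner_Integration.integral_cong)
    fix w assume "w \<in> space dA"
    then have "cmod (z * a w) < 1"
      using a(2)[of w] z by (simp add: norm_mult) (metis mult_left_le norm_ge_zero order_le_less_trans)
    from sums_mult[OF geometric_deriv_sums[OF this], of "f w"]
    show "(\<Sum>i. g i w) = f w * (1 / (1 - z * a w)\<^sup>2)"
      by (auto simp: sums_iff g_def power_mult_distrib mult_ac simp del: of_nat_Suc)
  qed simp
  finally show ?thesis by (simp add: g_def[abs_def] mult.assoc del: of_nat_Suc)
qed

text \<open>The Bergman kernel of the holomorphic functions plus its conjugate; 1 is subtracted
  because the constants belong to both halves. The value 0 off the disk follows the convention of
  \<open>L2h\<close>.\<close>

definition harmonic_kernel :: "complex \<Rightarrow> complex \<Rightarrow> complex" where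
  "harmonic_kernel z w = (if w \<in> \<DD> then 1 / (1 - z * cnj w)\<^sup>2 + 1 / (1 - cnj z * w)\<^sup>2 - 1 else 0)"

lemma one_minus_mult_neq_0: "cmod z < 1 \<Longrightarrow> cmod w \<le> 1 \<Longrightarrow> 1 - z * w \<noteq> (0::complex)"
  by (metis eq_iff_diff_eq_0 mult_left_le norm_ge_zero norm_mult norm_one not_less)

lemma bounded_kernel_summand:
  fixes a :: "complex \<Rightarrow> complex"
  assumes z: "cmod z < 1" and a: "continuous_on \<DD> a" "\<And>w. w \<in> \<DD> \<Longrightarrow> cmod (a w) \<le> 1"
  shows "continuous_on \<DD> (\<lambda>w. 1 / (1 - z * a w)\<^sup>2)"
    and "\<And>w. w \<in> \<DD> \<Longrightarrow> cmod (1 / (1 - z * a w)\<^sup>2) \<le> 1 / (1 - cmod z)\<^sup>2"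
proof -
  show "continuous_on \<DD> (\<lambda>w. 1 / (1 - z * a w)\<^sup>2)"
    using one_minus_mult_neq_0[OF z a(2)] by (intro continuous_intros a) auto
  fix w assume w: "w \<in> \<DD>"
  have "cmod (z * a w) \<le> cmod z" using a(2)[OF w] by (simp add: norm_mult mult_left_le)
  then have "1 - cmod z \<le> cmod (1 - z * a w)"
    by (smt (verit) norm_one norm_triangle_ineq2)
  then show "cmod (1 / (1 - z * a w)\<^sup>2) \<le> 1 / (1 - cmod z)\<^sup>2"
    using z by (auto simp: norm_divide norm_power intro!: divide_left_mono power_mono mult_pos_pos)
qed

text \<open>Adding back the integral of f undoes the subtracted 1 of the kernel. The series is then
  symmetric in z and \<open>cnj z\<close>, and its index 0 counts the constants twice.\<close>

lemma sums_integral_kernel: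
  assumes f: "integrable dA f" and z: "z \<in> \<DD>"
  shows "(\<lambda>i. of_nat (Suc i) * (z ^ i * (\<integral>w. f w * cnj w ^ i \<partial>dA) + cnj z ^ i * (\<integral>w. f w * w ^ i \<partial>dA)))
    sums ((\<integral>w. f w * harmonic_kernel z w \<partial>dA) + (\<integral>w. f w \<partial>dA))"
proof -
  have z: "cmod z < 1" "cmod (cnj z) < 1" using z by auto
  note s1 = sums_integral_dA_power[OF f _ _ z(1), of cnj] and s2 = sums_integral_dA_power[OF f _ _ z(2), of "\<lambda>w. w"]
  have int: "integrable dA (\<lambda>w. f w * (1 / (1 - y * a w)\<^sup>2))"
    if "cmod y < 1" and a: "continuous_on \<DD> a" "\<And>w. w \<in> \<DD> \<Longrightarrow> cmod (a w) \<le> 1" for a y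
  proof (rule Bochner_Integration.integrable_bound[OF integrable_mult_left[OF f, of "1 / (1 - cmod y)\<^sup>2"]])
    show "(\<lambda>w. f w * (1 / (1 - y * a w)\<^sup>2)) \<in> borel_measurable dA"
      using borel_measurable_dA_continuous[OF bounded_kernel_summand(1)[OF that]] f
      by (intro borel_measurable_times) auto
    show "AE w in dA. norm (f w * (1 / (1 - y * a w)\<^sup>2)) \<le> norm (f w * complex_of_real (1 / (1 - cmod y)\<^sup>2))"
      unfolding norm_mult norm_of_real
      by (rule AE_I2, rule mult_left_mono) (use bounded_kernel_summand(2)[OF that] in auto)
  qed
  have "(\<integral>w. f w * harmonic_kernel z w \<partial>dA) =
      (\<integral>w. f w * (1 / (1 - z * cnj w)\<^sup>2) + f w * (1 / (1 - cnj z * w)\<^sup>2) - f w \<partial>dA)"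
    by (rule Bochner_Integration.integral_cong) (auto simp: harmonic_kernel_def algebra_simps)
  also have "\<dots> = (\<integral>w. f w * (1 / (1 - z * cnj w)\<^sup>2) \<partial>dA) + (\<integral>w. f w * (1 / (1 - cnj z * w)\<^sup>2) \<partial>dA) - (\<integral>w. f w \<partial>dA)"
    using int[OF z(1), of cnj] int[OF z(2), of "\<lambda>w. w"] f
    by (subst Bochner_Integration.integral_diff Bochner_Integration.integral_add; (simp add: continuous_intros)?)+
  finally have "(\<integral>w. f w * harmonic_kernel z w \<partial>dA) + (\<integral>w. f w \<partial>dA) =
     (\<integral>w. f w * (1 / (1 - z * cnj w)\<^sup>2) \<partial>dA) + (\<integral>w. f w * (1 / (1 - cnj z * w)\<^sup>2) \<partial>dA)" by simp
  then show ?thesis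
    using sums_add[OF s1 s2] by (simp add: algebra_simps continuous_intros del: of_nat_Suc)
qed

text \<open>The orthogonal basis \<open>r\<^bsup>|k|\<^esup> e\<^bsup>ik\<theta>\<^esup>\<close> of \<open>L2h\<close>.\<close>

definition hpow :: "int \<Rightarrow> complex \<Rightarrow> complex" where
  "hpow k w = (if w \<in> \<DD> then if 0 \<le> k then w ^ nat k else cnj w ^ nat (- k) else 0)"

lemma cnj_unimodular: "cmod \<zeta> = 1 \<Longrightarrow> cnj \<zeta> = inverse \<zeta>"
  by (intro inverse_unique[symmetric]) (simp add: complex_norm_square[symmetric])

lemma hpow_rotate: "cmod \<zeta> = 1 \<Longrightarrow> hpow k (\<zeta> * w) = \<zeta> powi k * hpow k w"
  by (simp add: hpow_def norm_mult power_mult_distrib power_int_def cnj_unimodular)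

lemma cmod_hpow: "w \<in> \<DD> \<Longrightarrow> cmod (hpow k w) = cmod w ^ nat \<bar>k\<bar>"
  by (auto simp: hpow_def norm_power)

lemma borel_measurable_hpow [measurable]: "hpow k \<in> borel_measurable dA"
proof (rule borel_measurable_dA_continuous)
  have "continuous_on \<DD> (\<lambda>w. if 0 \<le> k then w ^ nat k else cnj w ^ nat (- k))"
    by (cases "0 \<le> k") (auto intro!: continuous_intros)
  then show "continuous_on \<DD> (hpow k)"
    by (rule continuous_on_eq) (simp add: hpow_def)
qed

lemma integrable_mult_hpow:
  assumes "integrable dA f" shows "integrable dA (\<lambda>w. f w * hpow k w)"
  by (rule Bochner_Integration.integrable_bound[OF assms])
    (use assms in \<open>auto simp: norm_mult cmod_hpow intro!: AE_I2 mult_left_le power_le_one\<close>)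

text \<open>An integrand of angular degree q pairs only with the power of degree -q, so the series
  reduces to its term of index |q|. The factor |q| + 1 is the reciprocal of the squared norm of
  \<open>hpow q\<close>. For q = 0 both halves of the term survive, and the surplus one is removed
  by the integral of f.\<close>

lemma integral_kernel_homogeneous:
  assumes f: "integrable dA f" and z: "z \<in> \<DD>"
    and h: "\<And>\<zeta> w. cmod \<zeta> = 1 \<Longrightarrow> w \<in> \<DD> \<Longrightarrow> f (\<zeta> * w) = \<zeta> powi q * f w"
  shows "(\<integral>w. f w * harmonic_kernel z w \<partial>dA) = of_int (\<bar>q\<bar> + 1) * (\<integral>w. f w * hpow (- q) w \<partial>dA) * hpow q z"
proof -
  have orth: "(\<integral>w. f w * hpow j w \<partial>dA) = 0" if "j \<noteq> - q" for j
  proof (rule integral_dA_homogeneous_eq_0)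
    show "q + j \<noteq> 0" using that by simp
    show "(\<lambda>w. f w * hpow j w) \<in> borel_measurable dA" using f by measurable
    fix \<zeta> w :: complex assume "cmod \<zeta> = 1" "w \<in> \<DD>"
    then show "f (\<zeta> * w) * hpow j (\<zeta> * w) = \<zeta> powi (q + j) * (f w * hpow j w)"
      by (subst power_int_add) (auto simp: h hpow_rotate)
  qed
  have p1: "(\<integral>w. f w * w ^ i \<partial>dA) = (\<integral>w. f w * hpow (int i) w \<partial>dA)"
    and p2: "(\<integral>w. f w * cnj w ^ i \<partial>dA) = (\<integral>w. f w * hpow (- int i) w \<partial>dA)" for i
    by (auto simp: hpow_def intro!: Bochner_Integration.integral_cong)
  have p0: "(\<integral>w. f w \<partial>dA) = (\<integral>w. f w * hpow 0 w \<partial>dA)"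
    using p1[of 0] by simp
  let ?I = "\<integral>w. f w * hpow (- q) w \<partial>dA"
  let ?t = "\<lambda>i. of_nat (Suc i) * (z ^ i * (\<integral>w. f w * cnj w ^ i \<partial>dA) + cnj z ^ i * (\<integral>w. f w * w ^ i \<partial>dA))"
  have "?t sums (\<Sum>i\<in>{nat \<bar>q\<bar>}. ?t i)"
    by (rule sums_finite) (auto simp: p1 p2 orth)
  from sums_unique2[OF sums_integral_kernel[OF f z] this]
  have e: "(\<integral>w. f w * harmonic_kernel z w \<partial>dA) = ?t (nat \<bar>q\<bar>) - (\<integral>w. f w \<partial>dA)"
    by (simp add: eq_diff_eq)
  consider "q > 0" | "q = 0" | "q < 0" by linarith
  then show ?thesis
    by cases (use z in \<open>simp_all add: e p1 p2 p0 orth hpow_def[of _ z] algebra_simps\<close>)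
qed

section \<open>Harmonic functions and their holomorphic decomposition\<close>

text \<open>With the partial derivatives as parameters, the witnesses hidden in
  \<open>harmonic_on\<close> can be obtained once and their properties used as a list of
  facts.\<close>

definition second_partials where
  "second_partials S u ux uy uxx uxy uyx uyy \<longleftrightarrow>
     (\<forall>z\<in>S.
        (u has_derivative (\<lambda>h. complex_of_real (Re h) * ux z + complex_of_real (Im h) * uy z)) (at z) \<and>
        (ux has_derivative (\<lambda>h. complex_of_real (Re h) * uxx z + complex_of_real (Im h) * uxy z)) (at z) \<and>
        (uy has_derivative (\<lambda>h. complex_of_real (Re h) * uyx z + complex_of_real (Im h) * uyy z)) (at z)) \<and>
     continuous_on S uxx \<and> continuous_on S uxy \<and>
     continuous_on S uyx \<and> continuous_on S uyy \<and>
     (\<forall>z\<in>S. uxx z + uyy z = 0)"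

lemma harmonic_on_iff:
  "harmonic_on S u \<longleftrightarrow> open S \<and> (\<exists>ux uy uxx uxy uyx uyy. second_partials S u ux uy uxx uxy uyx uyy)"
  unfolding harmonic_on_def second_partials_def ..

lemma second_partialsD:
  assumes "second_partials S u ux uy uxx uxy uyx uyy"
  shows
    "\<And>z. z\<in>S \<Longrightarrow> (u has_derivative (\<lambda>h. of_real (Re h) * ux z + of_real (Im h) * uy z)) (at z)"
    "\<And>z. z\<in>S \<Longrightarrow> (ux has_derivative (\<lambda>h. of_real (Re h) * uxx z + of_real (Im h) * uxy z)) (at z)"
    "\<And>z. z\<in>S \<Longrightarrow> (uy has_derivative (\<lambda>h. of_real (Re h) * uyx z + of_real (Im h) * uyy z)) (at z)"
    "continuous_on S uxx" "continuous_on S uxy" "continuous_on S uyx" "continuous_on S uyy"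
    "\<And>z. z\<in>S \<Longrightarrow> uxx z + uyy z = 0"
  using assms by (simp_all add: second_partials_def)

lemma harmonic_on_cong:
  assumes u: "harmonic_on S u" and eq: "\<And>z. z \<in> S \<Longrightarrow> v z = u z"
  shows "harmonic_on S v"
proof -
  have S: "open S" using u by (simp add: harmonic_on_def)
  have "(v has_derivative D) (at z)" if "(u has_derivative D) (at z)" "z \<in> S" for D z
    by (rule has_derivative_transform_within_open[OF that(1) S that(2)]) (simp add: eq)
  note tr = this
  obtain ux uy uxx uxy uyx uyy where "second_partials S u ux uy uxx uxy uyx uyy"
    using u unfolding harmonic_on_iff by blast
  note U = second_partialsD[OF this]
  show ?thesis unfolding harmonic_on_def
    by (rule conjI[OF S], rule exI[of _ ux], rule exI[of _ uy], rule exI[of _ uxx], rule exI[of _ uxy],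
        rule exI[of _ uyx], rule exI[of _ uyy]) (use U tr in auto)
qed

lemma harmonic_on_add:
  assumes "harmonic_on S u" "harmonic_on S v" shows "harmonic_on S (\<lambda>z. u z + v z)"
proof -
  obtain ux uy uxx uxy uyx uyy where "second_partials S u ux uy uxx uxy uyx uyy"
    using assms(1) unfolding harmonic_on_iff by blast
  note U = second_partialsD[OF this]
  obtain vx vy vxx vxy vyx vyy where "second_partials S v vx vy vxx vxy vyx vyy"
    using assms(2) unfolding harmonic_on_iff by blast
  note V = second_partialsD[OF this]
  show ?thesis unfolding harmonic_on_def
  proof (intro conjI exI ballI)
    show "open S" using assms by (simp add: harmonic_on_def)
    fix z assume z: "z \<in> S"
    show "((\<lambda>z. u z + v z) has_derivative (\<lambda>h. of_real (Re h) * (ux z + vx z) + of_real (Im h) * (uy z + vy z))) (at z)"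
      using has_derivative_add[OF U(1)[OF z] V(1)[OF z]] by (simp add: algebra_simps)
    show "((\<lambda>z. ux z + vx z) has_derivative (\<lambda>h. of_real (Re h) * (uxx z + vxx z) + of_real (Im h) * (uxy z + vxy z))) (at z)"
      using has_derivative_add[OF U(2)[OF z] V(2)[OF z]] by (simp add: algebra_simps)
    show "((\<lambda>z. uy z + vy z) has_derivative (\<lambda>h. of_real (Re h) * (uyx z + vyx z) + of_real (Im h) * (uyy z + vyy z))) (at z)"
      using has_derivative_add[OF U(3)[OF z] V(3)[OF z]] by (simp add: algebra_simps)
    show "uxx z + vxx z + (uyy z + vyy z) = 0"
      using U(8)[OF z] V(8)[OF z] by (simp only: add_eq_0_iff) simp
  qed (intro continuous_intros U V)+
qed

lemma harmonic_on_cnj: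
  assumes "harmonic_on S u" shows "harmonic_on S (\<lambda>z. cnj (u z))"
proof -
  obtain ux uy uxx uxy uyx uyy where "second_partials S u ux uy uxx uxy uyx uyy"
    using assms unfolding harmonic_on_iff by blast
  note U = second_partialsD[OF this]
  show ?thesis unfolding harmonic_on_def
  proof (intro conjI exI ballI)
    show "open S" using assms by (simp add: harmonic_on_def)
    fix z assume z: "z \<in> S"
    show "((\<lambda>z. cnj (u z)) has_derivative (\<lambda>h. of_real (Re h) * cnj (ux z) + of_real (Im h) * cnj (uy z))) (at z)"
      using has_derivative_cnj[OF U(1)[OF z]] by simp
    show "((\<lambda>z. cnj (ux z)) has_derivative (\<lambda>h. of_real (Re h) * cnj (uxx z) + of_real (Im h) * cnj (uxy z))) (at z)"
      using has_derivative_cnj[OF U(2)[OF z]] by simp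
    show "((\<lambda>z. cnj (uy z)) has_derivative (\<lambda>h. of_real (Re h) * cnj (uyx z) + of_real (Im h) * cnj (uyy z))) (at z)"
      using has_derivative_cnj[OF U(3)[OF z]] by simp
    show "cnj (uxx z) + cnj (uyy z) = 0"
      using arg_cong[OF U(8)[OF z], of cnj] by simp
  qed (intro continuous_intros U)+
qed

text \<open>Since f' acts by complex multiplication, the first partials are f' and i f'. Applying
  this again to f' makes the pure second partials f'' and -f''.\<close>

lemma holomorphic_imp_harmonic_on:
  assumes f: "f holomorphic_on S" and S: "open S" shows "harmonic_on S f"
proof -
  have d: "(g has_derivative (\<lambda>h. of_real (Re h) * deriv g z + of_real (Im h) * (\<i> * deriv g z))) (at z)"
    if "g holomorphic_on S" "z \<in> S" for g z
  proof -
    have "(g has_derivative (*) (deriv g z)) (at z)"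
      using holomorphic_derivI[OF that(1) S that(2)] by (simp add: has_field_derivative_def)
    also have "(*) (deriv g z) = (\<lambda>h. of_real (Re h) * deriv g z + of_real (Im h) * (\<i> * deriv g z))"
      by (rule ext) (simp add: complex_eq_iff algebra_simps)
    finally show ?thesis .
  qed
  have f': "deriv f holomorphic_on S" and f'': "deriv (deriv f) holomorphic_on S"
    using f S by (auto intro: holomorphic_deriv)
  have c: "continuous_on S (deriv (deriv f))" by (rule holomorphic_on_imp_continuous_on) fact
  have d2: "((\<lambda>z. \<i> * deriv f z) has_derivative
      (\<lambda>h. of_real (Re h) * (\<i> * deriv (deriv f) z) + of_real (Im h) * (- deriv (deriv f) z))) (at z)"
    if "z \<in> S" for z
    using has_derivative_mult_right[OF d[OF f' that], of \<i>] by (simp add: algebra_simps)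
  show ?thesis unfolding harmonic_on_def
  proof (intro conjI exI ballI)
    fix z assume "z \<in> S"
    then show "(f has_derivative (\<lambda>h. of_real (Re h) * deriv f z + of_real (Im h) * (\<i> * deriv f z))) (at z)"
      "(deriv f has_derivative (\<lambda>h. of_real (Re h) * deriv (deriv f) z + of_real (Im h) * (\<i> * deriv (deriv f) z))) (at z)"
      "((\<lambda>z. \<i> * deriv f z) has_derivative
        (\<lambda>h. of_real (Re h) * (\<i> * deriv (deriv f) z) + of_real (Im h) * (- deriv (deriv f) z))) (at z)"
      using d f f' d2 by auto
  qed (use S in \<open>auto intro!: continuous_intros c\<close>)
qed

text \<open>Two uses of the mean value theorem: in x for the increment of f from y = b to y = b + s,
  then in y for the derivative so obtained.\<close>

lemma mixed_difference:
  fixes f :: "real \<Rightarrow> real \<Rightarrow> real"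
  assumes s: "0 < s"
    and fx: "\<And>x y. a \<le> x \<Longrightarrow> x \<le> a + s \<Longrightarrow> b \<le> y \<Longrightarrow> y \<le> b + s \<Longrightarrow> ((\<lambda>x. f x y) has_real_derivative fx x y) (at x)"
    and fxy: "\<And>x y. a \<le> x \<Longrightarrow> x \<le> a + s \<Longrightarrow> b \<le> y \<Longrightarrow> y \<le> b + s \<Longrightarrow> (fx x has_real_derivative fxy x y) (at y)"
  shows "\<exists>x y. a < x \<and> x < a + s \<and> b < y \<and> y < b + s \<and>
     f (a + s) (b + s) - f (a + s) b - f a (b + s) + f a b = s * s * fxy x y"
proof -
  have "\<exists>x. a < x \<and> x < a + s \<and> (f (a + s) (b + s) - f (a + s) b) - (f a (b + s) - f a b)
      = (a + s - a) * (fx x (b + s) - fx x b)"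
    by (rule MVT2) (use s in \<open>auto intro!: derivative_eq_intros fx\<close>)
  then obtain x where x: "a < x" "x < a + s"
    "(f (a + s) (b + s) - f (a + s) b) - (f a (b + s) - f a b) = s * (fx x (b + s) - fx x b)" by auto
  have "\<exists>y. b < y \<and> y < b + s \<and> fx x (b + s) - fx x b = (b + s - b) * fxy x y"
    by (rule MVT2) (use s x in \<open>auto intro!: fxy\<close>)
  then obtain y where "b < y" "y < b + s" "fx x (b + s) - fx x b = s * fxy x y" by auto
  with x show ?thesis by (intro exI[of _ x] exI[of _ y]) auto
qed

text \<open>Schwarz's theorem. \<open>harmonic_on\<close> provides \<open>uxy\<close> and
  \<open>uyx\<close> as separate witnesses, and their equality is one of the Cauchy-Riemann
  conditions in \<open>harmonic_decomposition\<close>. The second difference over a small square is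
  symmetric in the two variables, so it equals s^2 times either mixed partial at some nearby point;
  continuity excludes a gap.\<close>

lemma mixed_partials_eq_real:
  fixes u ux uy uxx uxy uyx uyy :: "complex \<Rightarrow> real"
  assumes S: "open S" "z0 \<in> S"
    and u: "\<And>z. z\<in>S \<Longrightarrow> (u has_derivative (\<lambda>h. Re h * ux z + Im h * uy z)) (at z)"
    and ux: "\<And>z. z\<in>S \<Longrightarrow> (ux has_derivative (\<lambda>h. Re h * uxx z + Im h * uxy z)) (at z)"
    and uy: "\<And>z. z\<in>S \<Longrightarrow> (uy has_derivative (\<lambda>h. Re h * uyx z + Im h * uyy z)) (at z)"
    and c: "continuous_on S uxy" "continuous_on S uyx"
  shows "uxy z0 = uyx z0"
proof (rule ccontr)
  assume ne: "uxy z0 \<noteq> uyx z0"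
  define e where "e = \<bar>uxy z0 - uyx z0\<bar> / 2"
  have e: "e > 0" using ne by (simp add: e_def)
  have "isCont uxy z0" "isCont uyx z0" using c S by (auto simp: continuous_on_eq_continuous_at)
  then obtain d1 d2 where d: "d1 > 0" "\<And>z. dist z z0 < d1 \<Longrightarrow> dist (uxy z) (uxy z0) < e"
      "d2 > 0" "\<And>z. dist z z0 < d2 \<Longrightarrow> dist (uyx z) (uyx z0) < e"
    using e by (metis continuous_at_eps_delta dist_commute)
  obtain d3 where d3: "d3 > 0" "ball z0 d3 \<subseteq> S" using S by (auto simp: open_contains_ball)
  \<comment> \<open>Points of the square are within 2 s of its corner \<open>z0\<close>, so a
    quarter of the smallest radius keeps the square inside all three balls.\<close>
  define s where "s = min d1 (min d2 d3) / 4"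
  have s: "0 < s" "4 * s \<le> d1" "4 * s \<le> d2" "4 * s \<le> d3" using d d3 by (auto simp: s_def)
  have near: "dist (Complex x y) z0 < 4 * s" if "Re z0 \<le> x" "x \<le> Re z0 + s" "Im z0 \<le> y" "y \<le> Im z0 + s" for x y
  proof -
    have "dist (Complex x y) z0 \<le> \<bar>x - Re z0\<bar> + \<bar>y - Im z0\<bar>"
      using cmod_le[of "Complex x y - z0"] by (simp add: dist_norm)
    then show ?thesis using that s by simp
  qed
  have inS: "Complex x y \<in> S" if "Re z0 \<le> x" "x \<le> Re z0 + s" "Im z0 \<le> y" "y \<le> Im z0 + s" for x y
    using near[OF that] d3 s by (auto simp: dist_commute subset_iff)
  have dx: "((\<lambda>x. g (Complex x y)) has_real_derivative gx) (at x)"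
    if "(g has_derivative (\<lambda>h. Re h * gx + Im h * gy)) (at (Complex x y))" for g gx gy x y
  proof -
    have "((\<lambda>x. Complex x y) has_derivative (\<lambda>h. of_real h)) (at x)"
      unfolding Complex_eq by (auto intro!: derivative_eq_intros)
    from has_derivative_compose[OF this that] show ?thesis
      by (simp add: has_field_derivative_def mult.commute mult_commute_abs)
  qed
  have dy: "((\<lambda>y. g (Complex x y)) has_real_derivative gy) (at y)"
    if "(g has_derivative (\<lambda>h. Re h * gx + Im h * gy)) (at (Complex x y))" for g gx gy x y
  proof -
    have "((\<lambda>y. Complex x y) has_derivative (\<lambda>h. \<i> * of_real h)) (at y)"
      unfolding Complex_eq by (auto intro!: derivative_eq_intros)
    from has_derivative_compose[OF this that] show ?thesis
      by (simp add: has_field_derivative_def mult.commute mult_commute_abs)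
  qed
  obtain x y where xy: "Re z0 < x" "x < Re z0 + s" "Im z0 < y" "y < Im z0 + s"
     "u (Complex (Re z0 + s) (Im z0 + s)) - u (Complex (Re z0 + s) (Im z0)) -
      u (Complex (Re z0) (Im z0 + s)) + u (Complex (Re z0) (Im z0)) = s * s * uxy (Complex x y)"
    using mixed_difference[of s "Re z0" "Im z0" "\<lambda>x y. u (Complex x y)" "\<lambda>x y. ux (Complex x y)"
        "\<lambda>x y. uxy (Complex x y)"] s(1) dx[OF u[OF inS]] dy[OF ux[OF inS]] by blast
  obtain y' x' where xy': "Im z0 < y'" "y' < Im z0 + s" "Re z0 < x'" "x' < Re z0 + s"
     "u (Complex (Re z0 + s) (Im z0 + s)) - u (Complex (Re z0) (Im z0 + s)) -
      u (Complex (Re z0 + s) (Im z0)) + u (Complex (Re z0) (Im z0)) = s * s * uyx (Complex x' y')"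
    using mixed_difference[of s "Im z0" "Re z0" "\<lambda>y x. u (Complex x y)" "\<lambda>y x. uy (Complex x y)"
        "\<lambda>y x. uyx (Complex x y)"] s(1) dy[OF u[OF inS]] dx[OF uy[OF inS]] by blast
  have "s * s * uxy (Complex x y) = s * s * uyx (Complex x' y')" using xy(5) xy'(5) by linarith
  then have eq: "uxy (Complex x y) = uyx (Complex x' y')" using s(1) by simp
  have "dist (uxy (Complex x y)) (uxy z0) < e" "dist (uyx (Complex x' y')) (uyx z0) < e"
    using near[of x y] near[of x' y'] xy xy' s by (auto intro!: d)
  then show False unfolding e_def dist_real_def eq by (smt (verit, best) field_sum_of_halves)
qed

lemma mixed_partials_eq:
  fixes u ux uy uxx uxy uyx uyy :: "complex \<Rightarrow> complex"
  assumes S: "open S" "z0 \<in> S"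
    and u: "\<And>z. z\<in>S \<Longrightarrow> (u has_derivative (\<lambda>h. of_real (Re h) * ux z + of_real (Im h) * uy z)) (at z)"
    and ux: "\<And>z. z\<in>S \<Longrightarrow> (ux has_derivative (\<lambda>h. of_real (Re h) * uxx z + of_real (Im h) * uxy z)) (at z)"
    and uy: "\<And>z. z\<in>S \<Longrightarrow> (uy has_derivative (\<lambda>h. of_real (Re h) * uyx z + of_real (Im h) * uyy z)) (at z)"
    and c: "continuous_on S uxy" "continuous_on S uyx"
  shows "uxy z0 = uyx z0"
proof (rule complex_eqI)
  show "Re (uxy z0) = Re (uyx z0)"
    by (rule mixed_partials_eq_real[OF S, of "\<lambda>z. Re (u z)" "\<lambda>z. Re (ux z)" "\<lambda>z. Re (uy z)"
        "\<lambda>z. Re (uxx z)" _ _ "\<lambda>z. Re (uyy z)"])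
      (use has_derivative_Re[OF u] has_derivative_Re[OF ux] has_derivative_Re[OF uy] c in
        \<open>auto intro!: continuous_intros\<close>)
  show "Im (uxy z0) = Im (uyx z0)"
    by (rule mixed_partials_eq_real[OF S, of "\<lambda>z. Im (u z)" "\<lambda>z. Im (ux z)" "\<lambda>z. Im (uy z)"
        "\<lambda>z. Im (uxx z)" _ _ "\<lambda>z. Im (uyy z)"])
      (use has_derivative_Im[OF u] has_derivative_Im[OF ux] has_derivative_Im[OF uy] c in
        \<open>auto intro!: continuous_intros\<close>)
qed

text \<open>\<open>F\<close> and \<open>G\<close> are the Wirtinger derivatives of u with respect to
  z and its conjugate. Laplace's equation and the symmetry of the mixed partials make
  \<open>F\<close> complex differentiable, and on a convex set it has a primitive h.\<close>

lemma harmonic_decomposition: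
  assumes S: "convex S" and u: "harmonic_on S u"
  obtains h g where "h holomorphic_on S" "g holomorphic_on S" "\<And>z. z \<in> S \<Longrightarrow> u z = h z + cnj (g z)"
proof -
  have op: "open S" using u by (simp add: harmonic_on_def)
  obtain ux uy uxx uxy uyx uyy where "second_partials S u ux uy uxx uxy uyx uyy"
    using u unfolding harmonic_on_iff by blast
  note U = second_partialsD[OF this]
  have sym: "uxy z = uyx z" if "z \<in> S" for z
    by (rule mixed_partials_eq[OF op that U(1-3) U(5,6)])
  have holomorphic: "f holomorphic_on S" if "\<And>z. z \<in> S \<Longrightarrow> (f has_field_derivative f' z) (at z)" for f f'
    unfolding holomorphic_on_def field_differentiable_def
    by (intro ballI exI, rule has_field_derivative_at_within, rule that)
  define F where "F = (\<lambda>z. (ux z - \<i> * uy z) / 2)"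
  define G where "G z = (ux z + \<i> * uy z) / 2" for z
  have "(F has_field_derivative (uxx z - \<i> * uyx z) / 2) (at z)" if z: "z \<in> S" for z
  proof -
    have "(F has_derivative (\<lambda>h. ((of_real (Re h) * uxx z + of_real (Im h) * uxy z)
        - \<i> * (of_real (Re h) * uyx z + of_real (Im h) * uyy z)) / 2)) (at z)"
      unfolding F_def
      by (intro bounded_linear.has_derivative[OF bounded_linear_divide]
         has_derivative_diff has_derivative_mult_right U(2)[OF z] U(3)[OF z])
    also have "(\<lambda>h. ((of_real (Re h) * uxx z + of_real (Im h) * uxy z)
        - \<i> * (of_real (Re h) * uyx z + of_real (Im h) * uyy z)) / 2) = (*) ((uxx z - \<i> * uyx z) / 2)"
    proof
      fix h
      have yy: "uyy z = - uxx z" using U(8)[OF z] by (simp only: add_eq_0_iff)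
      show "((of_real (Re h) * uxx z + of_real (Im h) * uxy z)
        - \<i> * (of_real (Re h) * uyx z + of_real (Im h) * uyy z)) / 2 = (uxx z - \<i> * uyx z) / 2 * h"
        by (simp add: yy sym[OF z] complex_eq_iff algebra_simps)
    qed
    finally show ?thesis unfolding has_field_derivative_def .
  qed
  then have hF: "F holomorphic_on S"
    by (rule holomorphic)
  have "\<exists>h. \<forall>z\<in>S. (h has_field_derivative F z) (at z within S)"
  proof (rule holomorphic_convex_primitive'[OF S op hF])
    fix h assume "\<And>z. z \<in> S \<Longrightarrow> (h has_field_derivative F z) (at z within S)"
    then show ?thesis by (intro exI[of _ h] ballI)
  qed
  then obtain h where h: "\<forall>z\<in>S. (h has_field_derivative F z) (at z within S)" ..
  have h': "(h has_field_derivative F z) (at z)" if "z \<in> S" for z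
    using bspec[OF h that] by (simp add: at_within_open[OF that op])
  \<comment> \<open>Subtracting h removes the z-derivative of u. The remainder depends on the
    conjugate variable only, so its conjugate is holomorphic.\<close>
  define g where "g = (\<lambda>z. cnj (u z - h z))"
  have "(g has_field_derivative cnj (G z)) (at z)" if z: "z \<in> S" for z
  proof -
    have "(g has_derivative (\<lambda>k. cnj ((of_real (Re k) * ux z + of_real (Im k) * uy z) - F z * k))) (at z)"
      unfolding g_def
      by (intro has_derivative_cnj has_derivative_diff U(1)[OF z]
         h'[OF z, unfolded has_field_derivative_def])
    also have "(\<lambda>k. cnj ((of_real (Re k) * ux z + of_real (Im k) * uy z) - F z * k)) = (*) (cnj (G z))"
    proof
      fix k
      show "cnj ((of_real (Re k) * ux z + of_real (Im k) * uy z) - F z * k) = cnj (G z) * k"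
        by (simp add: F_def G_def complex_eq_iff field_simps)
    qed
    finally show ?thesis unfolding has_field_derivative_def .
  qed
  then have "g holomorphic_on S"
    by (rule holomorphic)
  moreover have "h holomorphic_on S"
    by (rule holomorphic[OF h'])
  moreover have "u z = h z + cnj (g z)" for z by (simp add: g_def)
  ultimately show ?thesis by (intro that[of h g])
qed

lemma harmonic_on_imp_continuous_on:
  assumes "harmonic_on S u" shows "continuous_on S u"
proof (rule continuous_at_imp_continuous_on, rule ballI)
  fix z assume z: "z \<in> S"
  obtain ux uy uxx uxy uyx uyy where "second_partials S u ux uy uxx uxy uyx uyy"
    using assms unfolding harmonic_on_iff by blast
  from second_partialsD(1)[OF this z] show "isCont u z"
    by (rule has_derivative_continuous)
qed

section \<open>The space \<open>L2h\<close> and its reproducing kernel\<close>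

lemma L2hD:
  assumes "u \<in> L2h"
  shows "harmonic_on \<DD> u" "integrable dA (\<lambda>z. (cmod (u z))\<^sup>2)" "\<And>z. z \<notin> \<DD> \<Longrightarrow> u z = 0"
  using assms by (auto simp: L2h_def)

lemma L2h_measurable: "u \<in> L2h \<Longrightarrow> u \<in> borel_measurable dA"
  by (intro borel_measurable_dA_continuous harmonic_on_imp_continuous_on L2hD)

lemma L2h_integrable:
  assumes "u \<in> L2h" shows "integrable dA u"
proof (rule Bochner_Integration.integrable_bound)
  show "integrable dA (\<lambda>z. 1 + (cmod (u z))\<^sup>2)"
    by (intro Bochner_Integration.integrable_add L2hD(2)[OF assms] finite_measure.integrable_const[OF finite_measure_dA])
  have "x \<le> 1 + x\<^sup>2" if "0 \<le> x" for x :: real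
    using sum_power2_ge_zero[of "x - 1" 0] that by (simp add: power2_diff)
  then show "AE z in dA. norm (u z) \<le> norm (1 + (cmod (u z))\<^sup>2)" by auto
qed (rule L2h_measurable[OF assms])

lemma L2h_bounded:
  assumes h: "harmonic_on \<DD> u" and b: "\<And>z. z \<in> \<DD> \<Longrightarrow> cmod (u z) \<le> B" and o: "\<And>z. z \<notin> \<DD> \<Longrightarrow> u z = 0"
  shows "u \<in> L2h"
proof -
  have "integrable dA (\<lambda>z. (cmod (u z))\<^sup>2)"
  proof (rule integrable_dA_bounded)
    show "(\<lambda>z. (cmod (u z))\<^sup>2) \<in> borel_measurable dA"
      using borel_measurable_dA_continuous[OF harmonic_on_imp_continuous_on[OF h]] by measurable
    show "norm ((cmod (u z))\<^sup>2) \<le> B\<^sup>2" if "z \<in> \<DD>" for z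
      using b[OF that] by (simp add: power_mono)
  qed
  then show ?thesis using h o by (simp add: L2h_def)
qed

lemma hpow_in_L2h: "hpow k \<in> L2h"
proof (rule L2h_bounded)
  have p: "harmonic_on \<DD> (\<lambda>w. w ^ n)" for n
    by (intro holomorphic_imp_harmonic_on holomorphic_intros) auto
  have "harmonic_on \<DD> (\<lambda>w. if 0 \<le> k then w ^ nat k else cnj w ^ nat (- k))"
    using p[of "nat k"] harmonic_on_cnj[OF p[of "nat (- k)"]] by (cases "0 \<le> k") auto
  then show "harmonic_on \<DD> (hpow k)" by (rule harmonic_on_cong) (simp add: hpow_def)
  show "cmod (hpow k z) \<le> 1" if "z \<in> \<DD>" for z
    using that by (simp add: cmod_hpow power_le_one)
qed (simp add: hpow_def)

lemma harmonic_kernel_in_L2h: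
  assumes z: "z \<in> \<DD>" shows "harmonic_kernel z \<in> L2h"
proof (rule L2h_bounded)
  have z': "cmod z < 1" "cmod (cnj z) < 1" using z by auto
  have hol: "(\<lambda>w. 1 / (1 - y * w)\<^sup>2) holomorphic_on \<DD>" if "cmod y < 1" for y
    using one_minus_mult_neq_0[OF that] by (intro holomorphic_intros) auto
  have "harmonic_on \<DD> (\<lambda>w. cnj (1 / (1 - cnj z * w)\<^sup>2))"
    by (intro harmonic_on_cnj holomorphic_imp_harmonic_on hol z') simp
  moreover have "harmonic_on \<DD> (\<lambda>w. 1 / (1 - cnj z * w)\<^sup>2 - 1)"
    by (intro holomorphic_imp_harmonic_on holomorphic_on_diff hol z' holomorphic_intros) simp
  ultimately have "harmonic_on \<DD> (\<lambda>w. cnj (1 / (1 - cnj z * w)\<^sup>2) + (1 / (1 - cnj z * w)\<^sup>2 - 1))"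
    by (rule harmonic_on_add)
  then show "harmonic_on \<DD> (harmonic_kernel z)"
    by (rule harmonic_on_cong) (simp add: harmonic_kernel_def)
  show "cmod (harmonic_kernel z w) \<le> 1 / (1 - cmod z)\<^sup>2 + 1 / (1 - cmod z)\<^sup>2 + 1" if w: "w \<in> \<DD>" for w
  proof -
    have 1: "cmod (1 / (1 - z * cnj w)\<^sup>2) \<le> 1 / (1 - cmod z)\<^sup>2"
      by (rule bounded_kernel_summand(2)[OF z'(1), of cnj]) (use w in \<open>auto intro: continuous_intros\<close>)
    have 2: "cmod (1 / (1 - cnj z * w)\<^sup>2) \<le> 1 / (1 - cmod z)\<^sup>2"
      using bounded_kernel_summand(2)[OF z'(2), of "\<lambda>w. w" w] w by (auto intro: continuous_intros)
    have "cmod (harmonic_kernel z w) \<le> cmod (1 / (1 - z * cnj w)\<^sup>2) + cmod (1 / (1 - cnj z * w)\<^sup>2) + cmod 1"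
      unfolding harmonic_kernel_def using w norm_triangle_ineq4 norm_triangle_ineq
      by (smt (verit, best))
    then show ?thesis using 1 2 by simp
  qed
qed (simp add: harmonic_kernel_def)

lemma harmonic_kernel_sym: "z \<in> \<DD> \<Longrightarrow> w \<in> \<DD> \<Longrightarrow> harmonic_kernel w z = harmonic_kernel z w"
  by (simp add: harmonic_kernel_def mult.commute)

lemma cnj_harmonic_kernel: "cnj (harmonic_kernel z w) = harmonic_kernel z w"
  by (simp add: harmonic_kernel_def)

text \<open>On the smaller disks the power series converge uniformly, and rotation invariance leaves a
  single term of the integrated series; then let the radius tend to 1.\<close>

lemma integral_series_mult_cnj_power:
  assumes u: "integrable dA u"
    and ab: "\<And>w. w \<in> \<DD> \<Longrightarrow> (\<lambda>k. a k * w ^ k + b k * cnj w ^ k) sums u w"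
    and sa: "\<And>\<rho>. 0 \<le> \<rho> \<Longrightarrow> \<rho> < 1 \<Longrightarrow> summable (\<lambda>k. (cmod (a k) + cmod (b k)) * \<rho> ^ k)"
  shows "(\<integral>w. u w * cnj w ^ j \<partial>dA) = (a j + (if j = 0 then b 0 else 0)) / of_nat (j + 1)"
proof -
  \<comment> \<open>At index 0 the powers of w and of \<open>cnj w\<close> are the same constant, so
    both coefficients contribute.\<close>
  let ?A = "a j + (if j = 0 then b 0 else 0)"
  define ind where "ind \<rho> w = (indicator (ball 0 \<rho>) w :: complex)" for \<rho> :: real and w :: complex
  have [measurable]: "ind \<rho> \<in> borel_measurable dA" for \<rho>
  proof -
    have "ball 0 \<rho> \<inter> \<DD> \<in> sets dA" by (auto simp: sets_dA_iff)
    then have "(indicator (ball 0 \<rho> \<inter> \<DD>) :: complex \<Rightarrow> complex) \<in> borel_measurable dA" by simp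
    then show ?thesis
      by (rule measurable_cong[THEN iffD1, rotated]) (simp add: ind_def indicator_def)
  qed
  have [measurable]: "(\<lambda>w. w ^ n) \<in> borel_measurable dA" "(\<lambda>w. cnj w ^ n) \<in> borel_measurable dA" for n
    by (intro borel_measurable_dA_continuous continuous_intros)+
  have mu[measurable]: "u \<in> borel_measurable dA" using u by simp
  have on_disk: "(\<integral>w. ind \<rho> w * (u w * cnj w ^ j) \<partial>dA) = ?A * (\<integral>w. ind \<rho> w * (w ^ j * cnj w ^ j) \<partial>dA)"
    if \<rho>: "0 \<le> \<rho>" "\<rho> < 1" for \<rho>
  proof -
    define c where "c k w = ind \<rho> w * ((a k * w ^ k + b k * cnj w ^ k) * cnj w ^ j)" for k w
    have nc: "norm (c k w) \<le> (cmod (a k) + cmod (b k)) * \<rho> ^ k" if "w \<in> \<DD>" for k w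
    proof (cases "w \<in> ball 0 \<rho>")
      case True
      then have w: "cmod w ^ k \<le> \<rho> ^ k" by (auto intro: power_mono)
      have "norm (c k w) \<le> cmod (a k * w ^ k + b k * cnj w ^ k)"
        using True that by (auto simp: c_def ind_def norm_mult norm_power intro!: mult_left_le power_le_one)
      also have "\<dots> \<le> (cmod (a k) + cmod (b k)) * cmod w ^ k"
        by (rule norm_triangle_le) (simp add: norm_mult norm_power algebra_simps)
      also have "\<dots> \<le> (cmod (a k) + cmod (b k)) * \<rho> ^ k" using w by (intro mult_left_mono) auto
      finally show ?thesis .
    next
      case False then show ?thesis using \<rho> by (simp add: c_def ind_def)
    qed
    have ic: "integrable dA (c k)" for k
      by (rule integrable_dA_bounded[OF _ nc]) (simp_all add: c_def[abs_def])
    have "(\<lambda>k. integral\<^sup>L dA (c k)) sums (\<integral>w. (\<Sum>k. c k w) \<partial>dA)"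
    proof (rule sums_integral)
      show "AE w in dA. summable (\<lambda>k. norm (c k w))"
        by (rule AE_I2, rule summable_comparison_test'[OF sa[OF \<rho>]]) (use nc in auto)
      show "summable (\<lambda>k. \<integral>w. norm (c k w) \<partial>dA)"
      proof (rule summable_comparison_test'[OF sa[OF \<rho>]])
        fix k
        have "(\<integral>w. norm (c k w) \<partial>dA) \<le> (\<integral>w. (cmod (a k) + cmod (b k)) * \<rho> ^ k \<partial>dA)"
          by (rule integral_mono)
            (use nc ic finite_measure.integrable_const[OF finite_measure_dA] in auto)
        then show "norm (\<integral>w. norm (c k w) \<partial>dA) \<le> (cmod (a k) + cmod (b k)) * \<rho> ^ k"
          by (simp add: measure_dA_disk)
      qed
    qed (rule ic)
    moreover have "(\<integral>w. (\<Sum>k. c k w) \<partial>dA) = (\<integral>w. ind \<rho> w * (u w * cnj w ^ j) \<partial>dA)"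
    proof (rule Bochner_Integration.integral_cong)
      fix w assume "w \<in> space dA"
      then have "(\<lambda>k. c k w) sums (ind \<rho> w * (u w * cnj w ^ j))"
        unfolding c_def by (intro sums_mult sums_mult2 ab) simp
      then show "(\<Sum>k. c k w) = ind \<rho> w * (u w * cnj w ^ j)" by (simp add: sums_iff)
    qed simp
    moreover have "integral\<^sup>L dA (c k) = (if k = j then ?A * (\<integral>w. ind \<rho> w * (w ^ j * cnj w ^ j) \<partial>dA) else 0)" for k
    proof -
      have m: "(\<lambda>w. ind \<rho> w * (w ^ k * cnj w ^ j)) \<in> borel_measurable dA"
        "(\<lambda>w. ind \<rho> w * (cnj w ^ k * cnj w ^ j)) \<in> borel_measurable dA"
        by (intro borel_measurable_times; simp)+
      have i1: "integrable dA (\<lambda>w. ind \<rho> w * (w ^ k * cnj w ^ j))"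
        by (rule integrable_dA_bounded[where B = 1], rule m)
          (auto simp: ind_def norm_mult norm_power indicator_def power_le_one mult_le_one)
      have i2: "integrable dA (\<lambda>w. ind \<rho> w * (cnj w ^ k * cnj w ^ j))"
        by (rule integrable_dA_bounded[where B = 1], rule m)
          (auto simp: ind_def norm_mult norm_power indicator_def power_le_one mult_le_one)
      have ind_rotate: "ind \<rho> (\<zeta> * w) = ind \<rho> w" if "cmod \<zeta> = 1" for \<zeta> w
        using that by (simp add: ind_def indicator_def norm_mult)
      have z1: "(\<integral>w. ind \<rho> w * (w ^ k * cnj w ^ j) \<partial>dA) = 0" if "k \<noteq> j"
      proof (rule integral_dA_homogeneous_eq_0[where k = "int k - int j"])
        fix \<zeta> w :: complex assume "cmod \<zeta> = 1" "w \<in> \<DD>"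
        moreover from this have "\<zeta> \<noteq> 0" by auto
        ultimately show "ind \<rho> (\<zeta> * w) * ((\<zeta> * w) ^ k * cnj (\<zeta> * w) ^ j) = \<zeta> powi (int k - int j) * (ind \<rho> w * (w ^ k * cnj w ^ j))"
          by (simp add: ind_rotate cnj_unimodular power_mult_distrib power_int_diff field_simps)
      qed (use that m in auto)
      \<comment> \<open>The integrand has angular degree -(k + j), which vanishes only for k = j =
        0.\<close>
      have z2: "(\<integral>w. ind \<rho> w * (cnj w ^ k * cnj w ^ j) \<partial>dA) = 0" if "k \<noteq> 0 \<or> j \<noteq> 0"
      proof (rule integral_dA_homogeneous_eq_0[where k = "- int k - int j"])
        fix \<zeta> w :: complex assume "cmod \<zeta> = 1" "w \<in> \<DD>"
        moreover from this have "\<zeta> \<noteq> 0" by auto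
        ultimately show "ind \<rho> (\<zeta> * w) * (cnj (\<zeta> * w) ^ k * cnj (\<zeta> * w) ^ j) = \<zeta> powi (- int k - int j) * (ind \<rho> w * (cnj w ^ k * cnj w ^ j))"
          by (simp add: ind_rotate cnj_unimodular power_mult_distrib power_int_diff power_int_minus field_simps)
      qed (use that m in auto)
      have "integral\<^sup>L dA (c k) = (\<integral>w. a k * (ind \<rho> w * (w ^ k * cnj w ^ j)) + b k * (ind \<rho> w * (cnj w ^ k * cnj w ^ j)) \<partial>dA)"
        by (rule Bochner_Integration.integral_cong) (auto simp: c_def algebra_simps)
      also have "\<dots> = a k * (\<integral>w. ind \<rho> w * (w ^ k * cnj w ^ j) \<partial>dA) + b k * (\<integral>w. ind \<rho> w * (cnj w ^ k * cnj w ^ j) \<partial>dA)"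
        using i1 i2 by simp
      also have "\<dots> = (if k = j then ?A * (\<integral>w. ind \<rho> w * (w ^ j * cnj w ^ j) \<partial>dA) else 0)"
        using z1 z2 by (cases "k = j"; cases "j = 0") (auto simp: algebra_simps)
      finally show ?thesis .
    qed
    ultimately have "(\<lambda>k. if k = j then ?A * (\<integral>w. ind \<rho> w * (w ^ j * cnj w ^ j) \<partial>dA) else 0) sums
        (\<integral>w. ind \<rho> w * (u w * cnj w ^ j) \<partial>dA)" by simp
    from sums_unique2[OF sums_single this] show ?thesis by simp
  qed
  define \<rho> where "\<rho> n = 1 - 1 / real (n + 2)" for n
  have \<rho>: "0 \<le> \<rho> n" "\<rho> n < 1" for n by (auto simp: \<rho>_def field_simps)
  have ind_lim: "(\<lambda>n. ind (\<rho> n) w) \<longlonglongrightarrow> 1" if "w \<in> \<DD>" for w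
  proof -
    have "\<rho> \<longlonglongrightarrow> 1" 
    using tendsto_diff[OF tendsto_const LIMSEQ_ignore_initial_segment[OF lim_1_over_n, of 2], of "1::real"]
    by (simp add: \<rho>_def[abs_def])
    then have "\<forall>\<^sub>F n in sequentially. cmod w < \<rho> n"
      by (rule order_tendstoD) (use that in auto)
    then have "\<forall>\<^sub>F n in sequentially. ind (\<rho> n) w = 1"
      by eventually_elim (simp add: ind_def)
    then show ?thesis by (rule tendsto_eventually)
  qed
  \<comment> \<open>The series may fail to converge uniformly up to the unit circle; the limit is
    therefore taken under the integral sign, dominated by |f|.\<close>
  have lim: "(\<lambda>n. \<integral>w. ind (\<rho> n) w * f w \<partial>dA) \<longlonglongrightarrow> (\<integral>w. f w \<partial>dA)" if f: "integrable dA f" for f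
  proof (rule integral_dominated_convergence[where w = "\<lambda>w. cmod (f w)"])
    show "AE w in dA. (\<lambda>n. ind (\<rho> n) w * f w) \<longlonglongrightarrow> f w"
    proof (rule AE_I2)
      fix w assume "w \<in> space dA"
      then show "(\<lambda>n. ind (\<rho> n) w * f w) \<longlonglongrightarrow> f w"
        using tendsto_mult[OF ind_lim tendsto_const, of w "f w"] by simp
    qed
    show "AE w in dA. norm (ind (\<rho> n) w * f w) \<le> cmod (f w)" for n
      by (intro AE_I2) (simp add: ind_def indicator_def)
  qed (use f in auto)
  have iu: "integrable dA (\<lambda>w. u w * cnj w ^ j)"
    by (rule Bochner_Integration.integrable_bound[OF u])
      (auto simp: norm_mult norm_power intro!: AE_I2 mult_left_le power_le_one)
  have ip: "integrable dA (\<lambda>w. w ^ j * cnj w ^ j)"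
    by (rule integrable_dA_bounded[where B = 1]) (auto simp: norm_mult norm_power power_le_one mult_le_one)
  have "(\<lambda>n. ?A * (\<integral>w. ind (\<rho> n) w * (w ^ j * cnj w ^ j) \<partial>dA)) \<longlonglongrightarrow> (\<integral>w. u w * cnj w ^ j \<partial>dA)"
    using lim[OF iu] by (simp add: on_disk[OF \<rho>])
  moreover have "(\<lambda>n. ?A * (\<integral>w. ind (\<rho> n) w * (w ^ j * cnj w ^ j) \<partial>dA)) \<longlonglongrightarrow> ?A * (\<integral>w. w ^ j * cnj w ^ j \<partial>dA)"
    by (intro tendsto_intros lim ip)
  ultimately have "(\<integral>w. u w * cnj w ^ j \<partial>dA) = ?A * (\<integral>w. w ^ j * cnj w ^ j \<partial>dA)"
    by (rule LIMSEQ_unique)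
  also have "(\<integral>w. w ^ j * cnj w ^ j \<partial>dA) = (\<integral>w. complex_of_real (cmod w ^ (2 * j)) \<partial>dA)"
    by (intro Bochner_Integration.integral_cong)
      (simp_all add: power_mult power_mult_distrib[symmetric] complex_norm_square[symmetric])
  also have "\<dots> = 1 / of_nat (j + 1)" by (rule integral_dA_cmod_power)
  finally show ?thesis by simp
qed

lemma summable_cmod_power_series:
  assumes "\<And>w. w \<in> \<DD> \<Longrightarrow> (\<lambda>k. a k * w ^ k) sums h w" and "0 \<le> \<rho>" "\<rho> < 1"
  shows "summable (\<lambda>k. cmod (a k) * \<rho> ^ k)"
proof -
  \<comment> \<open>The midpoint of \<rho> and 1: convergence at this larger radius forces absolute
    convergence at \<rho>.\<close>
  let ?r = "complex_of_real ((1 + \<rho>) / 2)"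
  have r: "cmod ?r = (1 + \<rho>) / 2" using assms by (simp only: norm_of_real) auto
  have "summable (\<lambda>k. norm (a k * complex_of_real \<rho> ^ k))"
  proof (rule powser_insidea)
    show "summable (\<lambda>k. a k * ?r ^ k)" using r assms(2,3) by (intro sums_summable[OF assms(1)]) (simp only: mem_ball_0, simp)
    show "norm (complex_of_real \<rho>) < norm ?r" using r assms by simp
  qed
  then show ?thesis using assms by (simp add: norm_mult norm_power)
qed

text \<open>The expansions of h and g give all integrals of u against powers of w and
  \<open>cnj w\<close>. In the kernel series the factor i + 1 cancels the denominators, which
  rebuilds u(z) together with one extra a(0) + b(0). This is the integral of u that
  \<open>sums_integral_kernel\<close> carries along.\<close>

lemma harmonic_kernel_reproducing:
  assumes u: "u \<in> L2h" and z: "z \<in> \<DD>"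
  shows "(\<integral>w. u w * harmonic_kernel z w \<partial>dA) = u z"
proof -
  obtain h g where hg: "h holomorphic_on \<DD>" "g holomorphic_on \<DD>" "\<And>w. w \<in> \<DD> \<Longrightarrow> u w = h w + cnj (g w)"
    using harmonic_decomposition[OF convex_ball L2hD(1)[OF u]] by metis
  define a where "a k = (deriv ^^ k) h 0 / fact k" for k
  define c where "c k = (deriv ^^ k) g 0 / fact k" for k
  define b where "b k = cnj (c k)" for k
  have a: "(\<lambda>k. a k * w ^ k) sums h w" if "w \<in> \<DD>" for w
    using holomorphic_power_series[OF hg(1) that] by (simp add: a_def)
  have c: "(\<lambda>k. c k * w ^ k) sums g w" if "w \<in> \<DD>" for w
    using holomorphic_power_series[OF hg(2) that] by (simp add: c_def)
  have b: "(\<lambda>k. b k * cnj w ^ k) sums cnj (g w)" if "w \<in> \<DD>" for w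
    using c[OF that] by (subst sums_cnj[symmetric]) (simp add: b_def)
  have iu: "integrable dA u" by (rule L2h_integrable[OF u])
  have iu': "integrable dA (\<lambda>w. cnj (u w))" using iu by simp
  have sums: "(\<lambda>k. a k * w ^ k + b k * cnj w ^ k) sums u w" if "w \<in> \<DD>" for w
    using sums_add[OF a[OF that] b[OF that]] hg(3)[OF that] by simp
  have sums': "(\<lambda>k. cnj (b k) * w ^ k + cnj (a k) * cnj w ^ k) sums cnj (u w)" if "w \<in> \<DD>" for w
    using sums[OF that] by (subst sums_cnj[symmetric]) (simp add: add.commute)
  have summ: "summable (\<lambda>k. (cmod (a k) + cmod (b k)) * \<rho> ^ k)" if "0 \<le> \<rho>" "\<rho> < 1" for \<rho>
    using summable_add[OF summable_cmod_power_series[OF a that] summable_cmod_power_series[OF c that]]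
    by (simp add: b_def algebra_simps)
  have summ': "summable (\<lambda>k. (cmod (cnj (b k)) + cmod (cnj (a k))) * \<rho> ^ k)" if "0 \<le> \<rho>" "\<rho> < 1" for \<rho>
    using summ[OF that] by (simp add: add.commute)
  have I1: "(\<integral>w. u w * cnj w ^ j \<partial>dA) = (a j + (if j = 0 then b 0 else 0)) / of_nat (Suc j)" for j
    using integral_series_mult_cnj_power[OF iu sums summ] by simp
  \<comment> \<open>Conjugating u exchanges the roles of the two coefficient sequences.\<close>
  have I2: "(\<integral>w. u w * w ^ j \<partial>dA) = (b j + (if j = 0 then a 0 else 0)) / of_nat (Suc j)" for j
  proof -
    have "cnj (\<integral>w. u w * w ^ j \<partial>dA) = (\<integral>w. cnj (u w) * cnj w ^ j \<partial>dA)"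
      by (subst Bochner_Integration.integral_cnj[symmetric]) simp
    also have "\<dots> = (cnj (b j) + (if j = 0 then cnj (a 0) else 0)) / of_nat (Suc j)"
      using integral_series_mult_cnj_power[OF iu' sums' summ'] by simp
    finally show ?thesis
      by (subst complex_cnj_cancel_iff[symmetric]) (simp del: of_nat_Suc)
  qed
  have t: "of_nat (Suc i) * (z ^ i * (\<integral>w. u w * cnj w ^ i \<partial>dA) + cnj z ^ i * (\<integral>w. u w * w ^ i \<partial>dA))
      = (a i * z ^ i + b i * cnj z ^ i) + (if i = 0 then a 0 + b 0 else 0)" for i
    unfolding I1 I2 by (cases i) (simp_all add: field_simps del: of_nat_Suc)
  have "(\<lambda>i. (a i * z ^ i + b i * cnj z ^ i) + (if i = 0 then a 0 + b 0 else 0)) sums (u z + (a 0 + b 0))"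
    using sums_add[OF sums[OF z] sums_single[of 0 "\<lambda>i. a 0 + b 0"]] by simp
  from sums_unique2[OF this sums_integral_kernel[OF iu z, unfolded t]]
  show ?thesis using I1[of 0] by simp
qed

text \<open>The description needs uniqueness. If R reproduces at z, pairing it with the kernel at w
  evaluates R at w in one order and the kernel of w at z in the other; the kernel is real and
  symmetric. Off the disk both functions are 0.\<close>

lemma rep_kernel_eq:
  assumes z: "z \<in> \<DD>" shows "rep_kernel z = harmonic_kernel z"
  unfolding rep_kernel_def
proof (rule the_equality)
  have K: "L2_inner u (harmonic_kernel w) = u w" if "u \<in> L2h" "w \<in> \<DD>" for u w
    using harmonic_kernel_reproducing[OF that] by (simp add: L2_inner_def cnj_harmonic_kernel)
  show "harmonic_kernel z \<in> L2h \<and> (\<forall>u\<in>L2h. u z = L2_inner u (harmonic_kernel z))"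
    using harmonic_kernel_in_L2h[OF z] K z by auto
  fix R assume R: "R \<in> L2h \<and> (\<forall>u\<in>L2h. u z = L2_inner u R)"
  show "R = harmonic_kernel z"
  proof
    fix w
    show "R w = harmonic_kernel z w"
    proof (cases "w \<in> \<DD>")
      case True
      have "cnj (R w) = cnj (L2_inner R (harmonic_kernel w))" using K R True by simp
      also have "\<dots> = L2_inner (harmonic_kernel w) R"
        unfolding L2_inner_def by (subst Bochner_Integration.integral_cnj[symmetric]) (simp add: mult.commute)
      also have "\<dots> = harmonic_kernel w z" using R harmonic_kernel_in_L2h[OF True] by simp
      also have "\<dots> = cnj (harmonic_kernel z w)"
        using harmonic_kernel_sym[OF z True] by (simp add: cnj_harmonic_kernel)
      finally show ?thesis by simp
    next
      case False
      then show ?thesis using R L2hD(3)[of R w] by (simp add: harmonic_kernel_def)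
    qed
  qed
qed

section \<open>Quasihomogeneous Toeplitz operators as weighted shifts\<close>

lemma hpow_polar: "w \<in> \<DD> \<Longrightarrow> hpow k w = of_real (cmod w ^ nat \<bar>k\<bar>) * cis (of_int k * Arg w)"
proof (cases "w = 0")
  case False
  assume "w \<in> \<DD>"
  have w: "w = of_real (cmod w) * cis (Arg w)" using rcis_cmod_Arg[of w] by (simp add: rcis_def)
  have w': "cnj w = of_real (cmod w) * cis (- Arg w)"
    by (subst w) (simp add: cis_cnj)
  show ?thesis
  proof (cases "0 \<le> k")
    case True
    have "hpow k w = (of_real (cmod w) * cis (Arg w)) ^ nat k"
      using True \<open>w \<in> \<DD>\<close> w by (simp add: hpow_def)
    then show ?thesis using True by (simp add: power_mult_distrib Complex.DeMoivre)
  next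
    case False
    have "hpow k w = (of_real (cmod w) * cis (- Arg w)) ^ nat (- k)"
      using False \<open>w \<in> \<DD>\<close> w' by (simp add: hpow_def)
    then show ?thesis using False by (simp add: power_mult_distrib Complex.DeMoivre)
  qed
qed (auto simp: hpow_def Arg_zero)

text \<open>The origin is excluded because \<open>Arg 0\<close> is a default value that does not
  move under rotation: the symbol takes the value \<phi>(0) there, which need not be
  homogeneous.\<close>

lemma quasihomogeneous_rotate:
  assumes \<zeta>: "cmod \<zeta> = 1" and w: "w \<noteq> 0"
  shows "quasihomogeneous p \<phi> (\<zeta> * w) = \<zeta> powi p * quasihomogeneous p \<phi> w"
proof -
  have c: "cis (of_int p * Arg z) = sgn z powi p" if "z \<noteq> 0" for z
    using cis_power_int[of "Arg z" p] cis_Arg[OF that] by simp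
  have "\<zeta> \<noteq> 0" using \<zeta> by auto
  moreover have "sgn \<zeta> = \<zeta>" using \<zeta> by (simp add: sgn_eq)
  ultimately show ?thesis using w \<zeta>
    by (simp add: quasihomogeneous_def c sgn_mult power_int_mult_distrib norm_mult)
qed

lemma AE_dA_nonzero: "AE w in dA. w \<noteq> 0"
proof -
  have "{0} \<in> sets dA" by (simp add: sets_dA_iff)
  then have "{0} \<in> null_sets dA" by (auto simp: null_sets_def emeasure_dA)
  from AE_not_in[OF this] show ?thesis by simp
qed

text \<open>In polar coordinates this is the Mellin-type integral of 2 \<phi>(r) r^(j + 1) over
  [0, 1].\<close>

definition radial_moment :: "(real \<Rightarrow> complex) \<Rightarrow> nat \<Rightarrow> complex" where
  "radial_moment \<phi> j = (\<integral>w. \<phi> (cmod w) * of_real (cmod w ^ j) \<partial>dA)"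

text \<open>The weight of the shift from \<open>hpow k\<close> to \<open>hpow (p + k)\<close>. The
  exponents |k| and |p + k| are the radial degrees of these two vectors.\<close>

definition toeplitz_coeff :: "int \<Rightarrow> (real \<Rightarrow> complex) \<Rightarrow> int \<Rightarrow> complex" where
  "toeplitz_coeff p \<phi> k = of_int (\<bar>p + k\<bar> + 1) * radial_moment \<phi> (nat (\<bar>k\<bar> + \<bar>p + k\<bar>))"

lemma toeplitz_integral_hpow:
  assumes F: "integrable dA (quasihomogeneous p \<phi>)"
  shows "toeplitz_integral (quasihomogeneous p \<phi>) (hpow k) = (\<lambda>z. toeplitz_coeff p \<phi> k * hpow (p + k) z)"
proof
  fix z
  let ?F = "quasihomogeneous p \<phi>"
  show "toeplitz_integral ?F (hpow k) z = toeplitz_coeff p \<phi> k * hpow (p + k) z"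
  proof (cases "z \<in> \<DD>")
    case z: True
    \<comment> \<open>The product is set to 0 at the origin, a null set, so that homogeneity holds
      at every point of the disk.\<close>
    define f where "f w = (if w = 0 then 0 else ?F w * hpow k w)" for w
    have iF: "integrable dA (\<lambda>w. ?F w * hpow k w)" by (rule integrable_mult_hpow[OF F])
    have f_alt: "f = (\<lambda>w. indicator (- {0}) w *\<^sub>R (?F w * hpow k w))"
      by (auto simp: f_def fun_eq_iff)
    have "(\<lambda>w. indicator (- {0}) w *\<^sub>R (?F w * hpow k w)) \<in> borel_measurable dA"
    proof (rule borel_measurable_scaleR)
      have "\<DD> - {0} \<in> sets dA" by (auto simp: sets_dA_iff)
      then have "(indicator (\<DD> - {0}) :: complex \<Rightarrow> real) \<in> borel_measurable dA" by simp
      then show "(indicator (- {0}) :: complex \<Rightarrow> real) \<in> borel_measurable dA"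
        by (rule measurable_cong[THEN iffD1, rotated]) (auto simp: indicator_def)
    qed (use iF in auto)
    then have mf: "f \<in> borel_measurable dA" by (simp add: f_alt)
    have ae: "AE w in dA. f w = ?F w * hpow k w"
      using AE_dA_nonzero by eventually_elim (simp add: f_def)
    have "integrable dA f"
      using iF ae by (subst integrable_cong_AE[OF mf borel_measurable_integrable[OF iF]])
    have mK: "harmonic_kernel z \<in> borel_measurable dA"
      by (rule L2h_measurable[OF harmonic_kernel_in_L2h[OF z]])
    have "toeplitz_integral ?F (hpow k) z = (\<integral>w. ?F w * hpow k w * harmonic_kernel z w \<partial>dA)"
      using z by (simp add: toeplitz_integral_def rep_kernel_eq)
    also have "\<dots> = (\<integral>w. f w * harmonic_kernel z w \<partial>dA)"
      using mf mK iF ae by (intro integral_cong_AE) auto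
    also have "\<dots> = of_int (\<bar>p + k\<bar> + 1) * (\<integral>w. f w * hpow (- (p + k)) w \<partial>dA) * hpow (p + k) z"
    proof (rule integral_kernel_homogeneous[OF \<open>integrable dA f\<close> z])
      fix \<zeta> w :: complex assume "cmod \<zeta> = 1" "w \<in> \<DD>"
      moreover from this have "\<zeta> \<noteq> 0" by auto
      ultimately show "f (\<zeta> * w) = \<zeta> powi (p + k) * f w"
        by (simp add: f_def quasihomogeneous_rotate hpow_rotate power_int_add)
    qed
    also have "(\<integral>w. f w * hpow (- (p + k)) w \<partial>dA) = (\<integral>w. ?F w * hpow k w * hpow (- (p + k)) w \<partial>dA)"
      using mf iF ae by (intro integral_cong_AE) auto
    also have "\<dots> = radial_moment \<phi> (nat (\<bar>k\<bar> + \<bar>p + k\<bar>))"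
      unfolding radial_moment_def
    proof (rule Bochner_Integration.integral_cong)
      fix w assume "w \<in> space dA"
      then have w: "w \<in> \<DD>" by simp
      have "cis (of_int p * Arg w) * cis (of_int k * Arg w) * cis (of_int (- (p + k)) * Arg w) = 1"
        by (simp add: cis_mult algebra_simps)
      moreover have "nat (\<bar>k\<bar> + \<bar>p + k\<bar>) = nat \<bar>k\<bar> + nat \<bar>- (p + k)\<bar>" by simp
      ultimately show "?F w * hpow k w * hpow (- (p + k)) w = \<phi> (cmod w) * of_real (cmod w ^ nat (\<bar>k\<bar> + \<bar>p + k\<bar>))"
        unfolding quasihomogeneous_def hpow_polar[OF w] 
        by (simp only: power_add of_real_mult) (simp add: mult_ac)
    qed simp
    finally show ?thesis by (simp add: toeplitz_coeff_def)
  next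
    case False
    then show ?thesis by (simp add: toeplitz_integral_def hpow_def)
  qed
qed

lemma hpow_in_harmonic_polys: "hpow k \<in> harmonic_polys"
proof -
  define a b :: "nat \<Rightarrow> complex"
    where "a j = (if j = nat k \<and> 0 \<le> k then 1 else 0)" and "b j = (if j = nat (- k) \<and> k < 0 then 1 else 0)" for j
  have "(\<Sum>j\<le>nat \<bar>k\<bar>. a j * z ^ j + b j * cnj z ^ j) = (if 0 \<le> k then z ^ nat k else cnj z ^ nat (- k))" for z
    by (cases "0 \<le> k") (simp_all add: a_def b_def sum.distrib if_distrib[of "\<lambda>x. x * _"] cong: if_cong)
  then have "hpow k = (\<lambda>z. if z \<in> \<DD> then \<Sum>j\<le>nat \<bar>k\<bar>. a j * z ^ j + b j * cnj z ^ j else 0)"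
    by (auto simp: hpow_def fun_eq_iff)
  then show ?thesis unfolding harmonic_polys_def by blast
qed

text \<open>\<open>toeplitz\<close> is an arbitrary choice, so the value is read off from its
  specification on harmonic polynomials and its linearity. The scalar c allows the rule to be
  applied again to the image of a basis vector.\<close>

lemma toeplitz_hpow:
  assumes "admissible_symbol (quasihomogeneous p \<phi>)"
  shows "toeplitz (quasihomogeneous p \<phi>) (\<lambda>z. c * hpow k z) = (\<lambda>z. c * toeplitz_coeff p \<phi> k * hpow (p + k) z)"
proof -
  have "extends_toeplitz (quasihomogeneous p \<phi>) (toeplitz (quasihomogeneous p \<phi>))"
    unfolding toeplitz_def using assms by (intro someI_ex[of "extends_toeplitz _"]) (simp add: admissible_symbol_def)
  then have e: "toeplitz (quasihomogeneous p \<phi>) (\<lambda>z. c * hpow k z) = (\<lambda>z. c * toeplitz (quasihomogeneous p \<phi>) (hpow k) z)"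
    and "toeplitz (quasihomogeneous p \<phi>) (hpow k) = toeplitz_integral (quasihomogeneous p \<phi>) (hpow k)"
    using hpow_in_L2h[of k] hpow_in_harmonic_polys[of k]
    by (auto simp: extends_toeplitz_def bounded_operator_L2h_def)
  then show ?thesis using toeplitz_integral_hpow[of p \<phi> k] assms
    by (simp add: admissible_symbol_def mult.assoc)
qed

lemma commuting_toeplitz_coeff:
  assumes F: "admissible_symbol (quasihomogeneous p \<phi>)" and G: "admissible_symbol (quasihomogeneous q \<psi>)"
    and c: "commute_on_L2h (toeplitz (quasihomogeneous p \<phi>)) (toeplitz (quasihomogeneous q \<psi>))"
  shows "toeplitz_coeff q \<psi> k * toeplitz_coeff p \<phi> (q + k) = toeplitz_coeff p \<phi> k * toeplitz_coeff q \<psi> (p + k)"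
proof -
  have "toeplitz (quasihomogeneous p \<phi>) (hpow k) = (\<lambda>z. toeplitz_coeff p \<phi> k * hpow (p + k) z)"
    "toeplitz (quasihomogeneous q \<psi>) (hpow k) = (\<lambda>z. toeplitz_coeff q \<psi> k * hpow (q + k) z)"
    using toeplitz_hpow[OF F, of 1 k] toeplitz_hpow[OF G, of 1 k] by simp_all
  note one = this toeplitz_hpow[OF F] toeplitz_hpow[OF G]
  \<comment> \<open>Both sides are multiples of one basis vector; 1/2 is a nonzero point of the
    disk, where no \<open>hpow\<close> vanishes, so the scalars can be compared.\<close>
  have "toeplitz (quasihomogeneous p \<phi>) (toeplitz (quasihomogeneous q \<psi>) (hpow k)) (1/2)
      = toeplitz (quasihomogeneous q \<psi>) (toeplitz (quasihomogeneous p \<phi>) (hpow k)) (1/2)"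
    using c hpow_in_L2h[of k] by (simp add: commute_on_L2h_def)
  then have "toeplitz_coeff q \<psi> k * toeplitz_coeff p \<phi> (q + k) * hpow (p + (q + k)) (1/2)
      = toeplitz_coeff p \<phi> k * toeplitz_coeff q \<psi> (p + k) * hpow (q + (p + k)) (1/2)"
    by (simp only: one)
  moreover have "hpow (q + (p + k)) (1/2) \<noteq> 0" by (simp add: hpow_def)
  moreover have "p + (q + k) = q + (p + k)" by simp
  ultimately show ?thesis by simp
qed

section \<open>A radial function is determined by its moments along a progression\<close>

text \<open>The set where f is positive is approximated from inside by closed sets T. Continuous
  functions approximate the indicator of T, so f has integral 0 over T. As f is positive there, T is
  null.\<close>

lemma AE_nonpos_if_integrals_vanish:
  fixes f :: "complex \<Rightarrow> real"
  assumes f: "integrable dA f"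
    and z: "\<And>g. continuous_on UNIV g \<Longrightarrow> (\<integral>w. f w * g w \<partial>dA) = 0"
  shows "AE w in dA. f w \<le> 0"
proof -
  define S where "S = {w \<in> \<DD>. f w > 0}"
  have mf: "f \<in> borel_measurable dA" using f by simp
  have "{w \<in> space dA. f w > 0} \<in> sets dA" using mf by measurable
  then have SdA: "S \<in> sets dA" by (simp add: S_def)
  then have S: "S \<in> sets lebesgue" by (simp add: sets_dA_iff)
  have small: "emeasure lebesgue S \<le> ennreal e" if e: "e > 0" for e
  proof -
    obtain T where T: "closed T" "T \<subseteq> S" "emeasure lebesgue (S - T) < ennreal e"
      by (rule sets_lebesgue_inner_closed[OF S e])
    have TdA: "T \<in> sets dA" using T by (auto simp: sets_dA_iff S_def)
    have T0: "emeasure lebesgue T = 0"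
    proof (cases "T = {}")
      case False
      \<comment> \<open>Tent functions with value 1 on T that drop to 0 within distance 1 / n of it;
        their limit is the indicator because T is closed.\<close>
      define g where "g n w = max 0 (1 - real n * infdist w T)" for n w
      have cg: "continuous_on UNIV (g n)" for n
        unfolding g_def by (intro continuous_intros)
      have mg: "g n \<in> borel_measurable dA" for n
        by (intro borel_measurable_dA_continuous continuous_on_subset[OF cg]) simp
      have lim: "(\<lambda>n. g n w) \<longlonglongrightarrow> indicator T w" for w
      proof (cases "w \<in> T")
        case True then show ?thesis by (simp add: g_def)
      next
        case w: False
        then have p: "infdist w T > 0"
          using False T(1) by (metis in_closed_iff_infdist_zero infdist_nonneg less_eq_real_def)
        obtain N where N: "1 < real N * infdist w T" using reals_Archimedean3[OF p] by blast
        have "\<forall>\<^sub>F n in sequentially. g n w = 0"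
          using eventually_ge_at_top[of N]
        proof eventually_elim
          case (elim n)
          then have "real N * infdist w T \<le> real n * infdist w T" using p by simp
          then show ?case using N by (simp add: g_def)
        qed
        then show ?thesis using w by (simp add: tendsto_eventually)
      qed
      have mi: "(indicator T :: complex \<Rightarrow> real) \<in> borel_measurable dA" using TdA by simp
      have "(\<lambda>n. \<integral>w. f w * g n w \<partial>dA) \<longlonglongrightarrow> (\<integral>w. f w * indicator T w \<partial>dA)"
      proof (rule integral_dominated_convergence[where w = "\<lambda>w. \<bar>f w\<bar>"])
        show "AE w in dA. (\<lambda>n. f w * g n w) \<longlonglongrightarrow> f w * indicator T w"
          by (intro AE_I2 tendsto_intros lim)
        show "AE w in dA. norm (f w * g n w) \<le> \<bar>f w\<bar>" for n
          by (intro AE_I2) (auto simp: g_def abs_mult infdist_nonneg intro!: mult_left_le)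
        show "integrable dA (\<lambda>w. \<bar>f w\<bar>)" using f by simp
      qed (use mf mg mi in auto)
      then have I0: "(\<integral>w. f w * indicator T w \<partial>dA) = 0"
        by (simp add: z[OF cg] LIMSEQ_const_iff)
      have int: "integrable dA (\<lambda>w. f w * indicator T w)"
        by (rule integrable_real_mult_indicator[OF TdA f])
      have "AE w in dA. 0 \<le> f w * indicator T w"
        using T by (intro AE_I2) (auto simp: S_def indicator_def)
      from integral_nonneg_eq_0_iff_AE[OF int this] I0
      have "AE w in dA. f w * indicator T w = 0" by simp
      then have "AE w in dA. w \<notin> T"
        by eventually_elim (use T in \<open>auto simp: S_def indicator_def\<close>)
      then have "emeasure dA T = 0"
        using TdA T by (subst (asm) AE_iff_measurable[OF TdA]) (auto simp: S_def)
      then show ?thesis using TdA by (simp add: emeasure_dA)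
    qed simp
    have TL: "T \<in> sets lebesgue" using TdA by (simp add: sets_dA_iff)
    have "S = (S - T) \<union> T" using T by auto
    then have "emeasure lebesgue S \<le> emeasure lebesgue (S - T) + emeasure lebesgue T"
      using emeasure_subadditive[of "S - T" lebesgue T] S TL by auto
    also have "\<dots> \<le> ennreal e" using T T0 by (simp add: less_imp_le)
    finally show ?thesis .
  qed
  have "emeasure lebesgue S \<le> 0"
    by (rule ennreal_le_epsilon) (simp add: small)
  then have "emeasure dA S = 0" using SdA by (simp add: emeasure_dA)
  then have "S \<in> null_sets dA" using SdA by auto
  from AE_not_in[OF this] show ?thesis
    by (rule AE_mp) (auto simp: S_def)
qed

lemma AE_zero_if_integrals_vanish:
  fixes f :: "complex \<Rightarrow> complex"
  assumes f: "integrable dA f"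
    and z: "\<And>g :: complex \<Rightarrow> real. continuous_on UNIV g \<Longrightarrow> (\<integral>w. f w * of_real (g w) \<partial>dA) = 0"
  shows "AE w in dA. f w = 0"
proof -
  have int: "integrable dA (\<lambda>w. f w * of_real (g w))" if cg: "continuous_on UNIV g" for g :: "complex \<Rightarrow> real"
  proof -
    obtain B where B: "\<And>w. w \<in> cball 0 1 \<Longrightarrow> norm (g w) \<le> B"
      using compact_imp_bounded[OF compact_continuous_image[OF continuous_on_subset[OF cg subset_UNIV] compact_cball[of 0 1]]]
      unfolding bounded_iff by blast
    have "g \<in> borel_measurable dA"
      by (intro borel_measurable_dA_continuous continuous_on_subset[OF cg]) simp
    then show ?thesis using f
      by (intro Bochner_Integration.integrable_bound[OF integrable_mult_left[OF f, of "of_real B"]])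
        (auto simp: norm_mult intro!: AE_I2 mult_left_mono order_trans[OF B abs_ge_self, unfolded real_norm_def])
  qed
  have "(\<integral>w. Re (f w) * g w \<partial>dA) = 0" "(\<integral>w. Im (f w) * g w \<partial>dA) = 0" if "continuous_on UNIV g" for g
    using integral_Re[OF int[OF that]] integral_Im[OF int[OF that]] by (simp_all add: z[OF that])
  note zz = this
  have "AE w in dA. Re (f w) \<le> 0" "AE w in dA. - Re (f w) \<le> 0" "AE w in dA. Im (f w) \<le> 0" "AE w in dA. - Im (f w) \<le> 0"
    by (rule AE_nonpos_if_integrals_vanish; use f zz in simp)+
  then show ?thesis by eventually_elim (simp add: complex_eq_iff)
qed

text \<open>A product of polynomials is absorbed one factor after the other, which is why f varies
  in the induction.\<close>

lemma polynomial_multiplier: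
  fixes V :: "(complex \<Rightarrow> complex) set" and y :: "complex \<Rightarrow> 'b::euclidean_space"
  assumes add: "\<And>f g. f \<in> V \<Longrightarrow> g \<in> V \<Longrightarrow> (\<lambda>w. f w + g w) \<in> V"
    and lin: "\<And>L f. bounded_linear L \<Longrightarrow> f \<in> V \<Longrightarrow> (\<lambda>w. f w * of_real (L (y w))) \<in> V"
    and const: "\<And>c f. f \<in> V \<Longrightarrow> (\<lambda>w. f w * of_real c) \<in> V"
    and P: "real_polynomial_function P" and f: "f \<in> V"
  shows "(\<lambda>w. f w * of_real (P (y w))) \<in> V"
  using P f
proof (induction P arbitrary: f rule: real_polynomial_function.induct)
  case (add P Q)
  from assms(1)[OF add.IH(1)[OF add.prems] add.IH(2)[OF add.prems]] show ?case
    by (simp add: algebra_simps)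
next
  case (mult P Q)
  from mult.IH(2)[OF mult.IH(1)[OF mult.prems]] show ?case
    by (simp add: mult.assoc)
qed (simp_all add: lin const)

text \<open>By Stone-Weierstrass g is within e of some polynomial P on K, which changes the integral
  by at most e times the integral of |f|.\<close>

lemma integral_continuous_multiplier_eq_0:
  fixes f :: "complex \<Rightarrow> complex" and y :: "complex \<Rightarrow> 'b::euclidean_space"
  assumes f: "integrable dA f" and K: "compact K" and y: "continuous_on \<DD> y" "\<And>w. w \<in> \<DD> \<Longrightarrow> y w \<in> K"
    and P: "\<And>P. real_polynomial_function P \<Longrightarrow> (\<integral>w. f w * of_real (P (y w)) \<partial>dA) = 0"
    and g: "continuous_on K g"
  shows "(\<integral>w. f w * of_real (g (y w)) \<partial>dA) = 0"
proof -
  have int: "integrable dA (\<lambda>w. f w * of_real (h (y w)))" if h: "continuous_on K h" for h :: "'b \<Rightarrow> real"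
  proof -
    obtain B where B: "\<And>w. w \<in> K \<Longrightarrow> norm (h w) \<le> B"
      using compact_imp_bounded[OF compact_continuous_image[OF h K]] unfolding bounded_iff by blast
    have "(\<lambda>w. h (y w)) \<in> borel_measurable dA"
      by (intro borel_measurable_dA_continuous continuous_on_compose2[OF h y(1)]) (use y in auto)
    then show ?thesis using f
      by (intro Bochner_Integration.integrable_bound[OF integrable_mult_left[OF f, of "of_real B"]])
        (use y in \<open>auto simp: norm_mult intro!: AE_I2 mult_left_mono order_trans[OF B abs_ge_self, unfolded real_norm_def]\<close>)
  qed
  have "cmod (\<integral>w. f w * of_real (g (y w)) \<partial>dA) \<le> e * (\<integral>w. cmod (f w) \<partial>dA)" if e: "e > 0" for e
  proof -
    obtain P where P': "real_polynomial_function P" "\<And>x. x \<in> K \<Longrightarrow> \<bar>g x - P x\<bar> < e"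
      using Stone_Weierstrass_real_polynomial_function[OF K g e] by metis
    have cP: "continuous_on K P"
      using P'(1) by (simp add: continuous_on_polymonial_function real_polynomial_function_eq)
    have "(\<integral>w. f w * of_real (g (y w)) \<partial>dA) = (\<integral>w. f w * of_real (g (y w)) - f w * of_real (P (y w)) \<partial>dA)"
      using P[OF P'(1)] int[OF g] int[OF cP] by simp
    also have "cmod \<dots> \<le> (\<integral>w. cmod (f w * of_real (g (y w)) - f w * of_real (P (y w))) \<partial>dA)"
      by (rule integral_norm_bound)
    also have "\<dots> \<le> (\<integral>w. e * cmod (f w) \<partial>dA)"
    proof (rule integral_mono)
      fix w assume "w \<in> space dA"
      then have "\<bar>g (y w) - P (y w)\<bar> \<le> e" using P'(2)[of "y w"] y by auto
      moreover have "cmod (f w * of_real (g (y w)) - f w * of_real (P (y w))) = cmod (f w) * \<bar>g (y w) - P (y w)\<bar>"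
        by (simp only: right_diff_distrib[symmetric] norm_mult of_real_diff[symmetric] norm_of_real)
      ultimately show "cmod (f w * of_real (g (y w)) - f w * of_real (P (y w))) \<le> e * cmod (f w)"
        by (metis mult.commute mult_left_mono norm_ge_zero)
    qed (use int[OF g] int[OF cP] f in auto)
    finally show ?thesis by simp
  qed
  note bd = this
  define I where "I = (\<integral>w. cmod (f w) \<partial>dA)"
  have I: "I \<ge> 0" by (simp add: I_def)
  \<comment> \<open>The norm I of f may be 0, hence the divisor I + 1 in the chosen
    accuracy.\<close>
  have "cmod (\<integral>w. f w * of_real (g (y w)) \<partial>dA) \<le> 0 + e" if "e > 0" for e
  proof -
    have "cmod (\<integral>w. f w * of_real (g (y w)) \<partial>dA) \<le> e / (I + 1) * I"
      using bd[of "e / (I + 1)"] I that by (simp add: I_def[symmetric])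
    also have "\<dots> \<le> e" using I that by (simp add: field_simps)
    finally show ?thesis by simp
  qed
  then have "cmod (\<integral>w. f w * of_real (g (y w)) \<partial>dA) \<le> 0" by (rule field_le_epsilon)
  then show ?thesis by simp
qed

lemma integrable_mult_bounded_dA:
  fixes f g :: "complex \<Rightarrow> complex"
  assumes f: "integrable dA f" and g: "continuous_on \<DD> g" "\<And>w. w \<in> \<DD> \<Longrightarrow> cmod (g w) \<le> 1"
  shows "integrable dA (\<lambda>w. f w * g w)"
  using borel_measurable_dA_continuous[OF g(1)] g(2) f
  by (intro Bochner_Integration.integrable_bound[OF f])
    (auto simp: norm_mult intro!: AE_I2 mult_left_le)

text \<open>Two rounds of Stone-Weierstrass: in the variable |w|^(2 s) on [0, 1], to pass from the
  given moments to all even ones, and in w on the closed disk. Between them, rotation invariance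
  turns even moments into all integrals against w^j times powers of \<open>cnj w\<close>.\<close>

lemma radial_moments_determine:
  fixes f :: "complex \<Rightarrow> complex" and s :: nat
  assumes f: "integrable dA f" and s: "s > 0"
    and rad: "\<And>\<zeta> w. cmod \<zeta> = 1 \<Longrightarrow> w \<in> \<DD> \<Longrightarrow> f (\<zeta> * w) = f w"
    and mom: "\<And>q. (\<integral>w. f w * of_real (cmod w ^ (2 * s * q)) \<partial>dA) = 0"
  shows "AE w in dA. f w = 0"
proof -
  let ?y = "\<lambda>w::complex. cmod w ^ (2 * s)"
  \<comment> \<open>Multiplying by |w|^(2 s) replaces q by q + 1, so this class is stable under
    polynomials in |w|^(2 s).\<close>
  define V :: "(complex \<Rightarrow> complex) set" where "V = {f. integrable dA f \<and> (\<forall>q. (\<integral>w. f w * of_real (cmod w ^ (2 * s * q)) \<partial>dA) = 0)}"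
  have cm: "continuous_on \<DD> (\<lambda>w. complex_of_real (cmod w ^ j))" for j by (intro continuous_intros)
  have cm1: "cmod (complex_of_real (cmod w ^ j)) \<le> 1" if "w \<in> \<DD>" for w j
    using that by (simp add: norm_power power_le_one)
  note im = integrable_mult_bounded_dA[OF _ cm cm1]
  have polyV: "(\<lambda>w. f w * of_real (P (?y w))) \<in> V" if P: "real_polynomial_function P" for P
  proof (rule polynomial_multiplier[OF _ _ _ P])
    show "f \<in> V" using f mom by (simp add: V_def)
    fix g assume g: "g \<in> V"
    then have ig: "integrable dA g" by (simp add: V_def)
    show "(\<lambda>w. g w * of_real c) \<in> V" for c
    proof -
      have "(\<integral>w. g w * of_real c * of_real (cmod w ^ (2 * s * q)) \<partial>dA) = of_real c * (\<integral>w. g w * of_real (cmod w ^ (2 * s * q)) \<partial>dA)" for q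
        by (subst Bochner_Integration.integral_mult_right_zero[symmetric]) (simp add: mult_ac)
      then show ?thesis using g by (simp add: V_def)
    qed
    show "(\<lambda>w. g w * of_real (L (?y w))) \<in> V" if L: "bounded_linear L" for L
    proof -
      have Lx: "L x = x * L 1" for x :: real
        using linear_scale[OF bounded_linear.linear[OF L], of x 1] by simp
      have "(\<integral>w. g w * of_real (L (?y w)) * of_real (cmod w ^ (2 * s * q)) \<partial>dA)
          = of_real (L 1) * (\<integral>w. g w * of_real (cmod w ^ (2 * s * Suc q)) \<partial>dA)" for q
        by (subst Lx, subst Bochner_Integration.integral_mult_right_zero[symmetric])
          (simp add: mult_ac power_add)
      moreover have "(\<integral>w. g w * of_real (cmod w ^ (2 * s * Suc q)) \<partial>dA) = 0" for q
        using g unfolding V_def by blast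
      moreover have "integrable dA (\<lambda>w. g w * of_real (L (?y w)))"
        by (subst Lx) (use im[OF ig, of "2 * s"] in \<open>simp add: mult.assoc[symmetric]\<close>)
      ultimately show ?thesis unfolding V_def by (simp only: mem_Collect_eq mult_zero_right simp_thms)
    qed
    show "(\<lambda>w. g w + h w) \<in> V" if h: "h \<in> V" for h
    proof -
      have "(\<integral>w. (g w + h w) * of_real (cmod w ^ (2 * s * q)) \<partial>dA) = 0" for q
      proof -
        have "(\<integral>w. (g w + h w) * of_real (cmod w ^ (2 * s * q)) \<partial>dA)
            = (\<integral>w. g w * of_real (cmod w ^ (2 * s * q)) + h w * of_real (cmod w ^ (2 * s * q)) \<partial>dA)"
          by (simp add: algebra_simps)
        also have "\<dots> = 0" using g h
          by (subst Bochner_Integration.integral_add) (auto simp: V_def intro!: im simp del: of_real_power)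
        finally show ?thesis .
      qed
      then show ?thesis using g h by (simp add: V_def)
    qed
  qed
  have P0: "(\<integral>w. f w * of_real (P (?y w)) \<partial>dA) = 0" if "real_polynomial_function P" for P
  proof -
    have "\<forall>q. (\<integral>w. f w * of_real (P (?y w)) * of_real (cmod w ^ (2 * s * q)) \<partial>dA) = 0"
      using polyV[OF that] by (simp add: V_def)
    from spec[OF this, of 0] show ?thesis by simp
  qed
  \<comment> \<open>|w|^(2 j) is the j-th power of the s-th root of |w|^(2 s), a continuous function
    of that variable though not a polynomial.\<close>
  have even: "(\<integral>w. f w * of_real (cmod w ^ (2 * j)) \<partial>dA) = 0" for j
  proof -
    have "(\<integral>w. f w * of_real (root s (?y w) ^ j) \<partial>dA) = 0"
      by (rule integral_continuous_multiplier_eq_0[OF f compact_Icc[of 0 1] _ _ P0])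
        (auto intro!: continuous_intros power_le_one simp: s)
    moreover have "root s (?y w) ^ j = cmod w ^ (2 * j)" for w
    proof -
      have "?y w = ((cmod w)\<^sup>2) ^ s" by (rule power_mult)
      then have "root s (?y w) = (cmod w)\<^sup>2" using s by (simp add: real_root_power_cancel)
      then show ?thesis by (simp add: power_mult)
    qed
    ultimately show ?thesis by simp
  qed
  have mixed: "(\<integral>w. f w * (w ^ j * cnj w ^ k) \<partial>dA) = 0" for j k
  proof (cases "j = k")
    case True
    have "(\<integral>w. f w * (w ^ j * cnj w ^ k) \<partial>dA) = (\<integral>w. f w * of_real (cmod w ^ (2 * j)) \<partial>dA)"
      unfolding True
      by (intro Bochner_Integration.integral_cong)
        (simp_all add: power_mult power_mult_distrib[symmetric] complex_norm_square[symmetric])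
    then show ?thesis by (simp only: even)
  next
    case False
    show ?thesis
    proof (rule integral_dA_homogeneous_eq_0[where k = "int j - int k"])
      have "(\<lambda>w. w ^ j * cnj w ^ k) \<in> borel_measurable dA"
        by (intro borel_measurable_dA_continuous continuous_intros)
      from borel_measurable_times[OF borel_measurable_integrable[OF f] this]
      show "(\<lambda>w. f w * (w ^ j * cnj w ^ k)) \<in> borel_measurable dA" .
      fix \<zeta> w :: complex assume "cmod \<zeta> = 1" "w \<in> \<DD>"
      moreover from this have "\<zeta> \<noteq> 0" by auto
      ultimately show "f (\<zeta> * w) * ((\<zeta> * w) ^ j * cnj (\<zeta> * w) ^ k) = \<zeta> powi (int j - int k) * (f w * (w ^ j * cnj w ^ k))"
        by (simp add: rad cnj_unimodular power_mult_distrib power_int_diff field_simps)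
    qed (use False in simp)
  qed
  define U :: "(complex \<Rightarrow> complex) set" where "U = {f. integrable dA f \<and> (\<forall>j k. (\<integral>w. f w * (w ^ j * cnj w ^ k) \<partial>dA) = 0)}"
  have im2: "integrable dA (\<lambda>w. h w * (w ^ j * cnj w ^ k))" if "integrable dA h" for h j k
    by (rule integrable_mult_bounded_dA[OF that])
      (auto intro!: continuous_intros mult_le_one power_le_one simp: norm_mult norm_power)
  have U_cmult: "(\<lambda>w. h w * c) \<in> U" if h: "h \<in> U" for h c
  proof -
    have "(\<integral>w. h w * c * (w ^ j * cnj w ^ k) \<partial>dA) = c * (\<integral>w. h w * (w ^ j * cnj w ^ k) \<partial>dA)" for j k
      by (subst Bochner_Integration.integral_mult_right_zero[symmetric]) (simp add: mult_ac)
    then show ?thesis using h by (simp add: U_def)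
  qed
  have U_add: "(\<lambda>w. g w + h w) \<in> U" if "g \<in> U" "h \<in> U" for g h
  proof -
    have "(\<integral>w. (g w + h w) * (w ^ j * cnj w ^ k) \<partial>dA) = 0" for j k
    proof -
      have "(\<integral>w. (g w + h w) * (w ^ j * cnj w ^ k) \<partial>dA)
          = (\<integral>w. g w * (w ^ j * cnj w ^ k) + h w * (w ^ j * cnj w ^ k) \<partial>dA)"
        by (simp add: algebra_simps)
      also have "\<dots> = 0" using that
        by (subst Bochner_Integration.integral_add) (auto simp: U_def intro!: im2)
      finally show ?thesis .
    qed
    then show ?thesis using that by (simp add: U_def)
  qed
  have U_w: "(\<lambda>w. h w * w) \<in> U" "(\<lambda>w. h w * cnj w) \<in> U" if h: "h \<in> U" for h
  proof -
    have ih: "integrable dA h" using h by (simp add: U_def)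
    have "(\<integral>w. h w * w * (w ^ j * cnj w ^ k) \<partial>dA) = (\<integral>w. h w * (w ^ Suc j * cnj w ^ k) \<partial>dA)"
      "(\<integral>w. h w * cnj w * (w ^ j * cnj w ^ k) \<partial>dA) = (\<integral>w. h w * (w ^ j * cnj w ^ Suc k) \<partial>dA)" for j k
      by (simp_all add: mult_ac)
    then show "(\<lambda>w. h w * w) \<in> U" "(\<lambda>w. h w * cnj w) \<in> U"
      using h im2[OF ih, of 1 0] im2[OF ih, of 0 1] by (simp_all add: U_def del: power_Suc)
  qed
  have polyU: "(\<lambda>w. f w * of_real (P w)) \<in> U" if P: "real_polynomial_function P" for P
  proof (rule polynomial_multiplier[OF U_add _ U_cmult P])
    show "f \<in> U" using f mixed by (simp add: U_def)
    fix L :: "complex \<Rightarrow> real" and g assume L: "bounded_linear L" and g: "g \<in> U"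
    \<comment> \<open>With this constant, L(w) is w \<alpha> plus its conjugate, so closure under
      multiplication by w, \<open>cnj w\<close> and complex scalars covers every real linear
      functional.\<close>
    define \<alpha> where "\<alpha> = Complex (L 1) (- L \<i>) / 2"
    have "complex_of_real (L w) = w * \<alpha> + cnj w * cnj \<alpha>" for w
    proof -
      have "L w = Re w * L 1 + Im w * L \<i>"
      proof -
        have "w = Re w *\<^sub>R 1 + Im w *\<^sub>R \<i>" by (simp add: complex_eq_iff)
        then have "L w = L (Re w *\<^sub>R 1 + Im w *\<^sub>R \<i>)" by simp
        then show ?thesis
          by (simp add: linear_add[OF bounded_linear.linear[OF L]] linear_scale[OF bounded_linear.linear[OF L]])
      qed
      then show ?thesis by (simp add: \<alpha>_def complex_eq_iff add_divide_distrib[symmetric])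
    qed
    then have "(\<lambda>w. g w * of_real (L w)) = (\<lambda>w. g w * w * \<alpha> + g w * cnj w * cnj \<alpha>)"
      by (simp add: algebra_simps)
    then show "(\<lambda>w. g w * of_real (L w)) \<in> U"
      using U_add[OF U_cmult[OF U_w(1)[OF g]] U_cmult[OF U_w(2)[OF g]]] by simp
  qed
  have P0': "(\<integral>w. f w * of_real (P w) \<partial>dA) = 0" if "real_polynomial_function P" for P
  proof -
    have "\<forall>j k. (\<integral>w. f w * of_real (P w) * (w ^ j * cnj w ^ k) \<partial>dA) = 0"
      using polyU[OF that] by (simp add: U_def)
    from this[rule_format, of 0 0] show ?thesis by simp
  qed
  show ?thesis
  proof (rule AE_zero_if_integrals_vanish[OF f])
    fix g :: "complex \<Rightarrow> real" assume "continuous_on UNIV g"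
    then show "(\<integral>w. f w * of_real (g w) \<partial>dA) = 0"
      by (intro integral_continuous_multiplier_eq_0[OF f compact_cball[of 0 1] _ _ P0'])
        (auto intro: continuous_on_subset)
  qed
qed

section \<open>The rational solution of the moment recurrence\<close>

text \<open>For \<open>t = (l + 1) / s\<close> and \<open>c = p / s\<close> this is, up to a constant factor, the only solution of the
  two-term recurrence that commutation imposes on the moments.\<close>

definition moment_profile :: "real \<Rightarrow> nat \<Rightarrow> real \<Rightarrow> real" where
  "moment_profile c m t = pochhammer (t + c + 1) m / pochhammer t (m + 1)"

lemma moment_profile_pos: "0 < t \<Longrightarrow> 0 \<le> c \<Longrightarrow> 0 < moment_profile c m t"
  by (simp add: moment_profile_def pochhammer_pos)

text \<open>Raising t by 1 drops the first factor of a Pochhammer symbol and appends a new last one,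
  in the numerator and in the denominator.\<close>

lemma moment_profile_step:
  assumes "0 < t" "0 \<le> c"
  shows "(t + 1 + c) * (t + real m + 1) * moment_profile c m (t + 1) = t * (t + c + real m + 1) * moment_profile c m t"
proof -
  have 1: "(t + 1 + c) * pochhammer (t + 1 + c + 1) m = pochhammer (t + c + 1) m * (t + c + real m + 1)"
    using pochhammer_rec[of "t + c + 1" m] pochhammer_rec'[of "t + c + 1" m] by (simp add: algebra_simps)
  have 2: "t * pochhammer (t + 1) (m + 1) = (t + real m + 1) * pochhammer t (m + 1)"
    using pochhammer_rec[of t "m + 1"] pochhammer_rec'[of t "m + 1"] by (simp add: algebra_simps)
  have p: "pochhammer (t + 1) (m + 1) > 0" "pochhammer t (m + 1) > 0" using assms by (auto intro: pochhammer_pos)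
  have "(t + 1 + c) * (t + real m + 1) * moment_profile c m (t + 1) =
      (t + real m + 1) * ((t + 1 + c) * pochhammer (t + 1 + c + 1) m) / pochhammer (t + 1) (m + 1)"
    by (simp add: moment_profile_def)
  also have "\<dots> = (t + real m + 1) * (pochhammer (t + c + 1) m * (t + c + real m + 1)) / pochhammer (t + 1) (m + 1)"
    by (simp only: 1)
  also have "\<dots> = t * (t + c + real m + 1) * moment_profile c m t"
  proof -
    have "(t + real m + 1) / pochhammer (t + 1) (m + 1) = t / pochhammer t (m + 1)"
      using p 2 by (subst frac_eq_eq) (auto simp: mult.commute)
    then have "(t + real m + 1) / pochhammer (t + 1) (m + 1) * (pochhammer (t + c + 1) m * (t + c + real m + 1))
       = t / pochhammer t (m + 1) * (pochhammer (t + c + 1) m * (t + c + real m + 1))" by simp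
    then show ?thesis by (simp add: moment_profile_def mult_ac)
  qed
  finally show ?thesis .
qed

text \<open>The simple fractions matter because, at t = (l + 1) / s, each of them is a multiple of a
  moment of a power of |w|. In the induction the new factor is 1 + c / (t + m + 1).\<close>

lemma moment_profile_partial_fractions:
  "\<exists>h. \<forall>t>0. moment_profile c m t = (\<Sum>j\<le>m. h j / (t + real j))"
proof (induction m)
  case 0
  show ?case by (intro exI[of _ "\<lambda>_. 1"]) (simp add: moment_profile_def)
next
  case (Suc m)
  then obtain h where h: "\<And>t. t > 0 \<Longrightarrow> moment_profile c m t = (\<Sum>j\<le>m. h j / (t + real j))" by auto
  \<comment> \<open>From 1 / (a b) = (1 / a - 1 / b) / (b - a) with a = t + j and b = t + m + 1,
    where b - a = m + 1 - j.\<close>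
  define d where "d j = c / (real m + 1 - real j)" for j
  define h' where "h' j = (if j \<le> m then h j * (1 + d j) else - (\<Sum>i\<le>m. h i * d i))" for j
  have "moment_profile c (Suc m) t = (\<Sum>j\<le>Suc m. h' j / (t + real j))" if t: "t > 0" for t
  proof -
    define b where "b = t + real m + 1"
    have b: "b > 0" using t by (simp add: b_def)
    have "moment_profile c (Suc m) t = moment_profile c m t * ((b + c) / b)"
      by (simp add: moment_profile_def pochhammer_rec' b_def algebra_simps)
    also have "\<dots> = (\<Sum>j\<le>m. h j / (t + real j) * ((b + c) / b))"
      by (simp only: h[OF t] sum_distrib_right)
    also have "\<dots> = (\<Sum>j\<le>m. h' j / (t + real j) - h j * d j / b)"
    proof (rule sum.cong)
      fix j assume "j \<in> {..m}"
      then have j: "j \<le> m" by simp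
      define e where "e = real m + 1 - real j"
      define a where "a = t + real j"
      have e: "e > 0" using j by (simp add: e_def)
      have a: "a > 0" using t by (simp add: a_def)
      have bb: "b = a + e" by (simp add: b_def a_def e_def)
      show "h j / (t + real j) * ((b + c) / b) = h' j / (t + real j) - h j * d j / b"
        using j a b e unfolding h'_def d_def a_def[symmetric] e_def[symmetric] bb
        by (simp add: divide_simps) (simp add: algebra_simps)
    qed simp
    also have "\<dots> = (\<Sum>j\<le>Suc m. h' j / (t + real j))"
      by (simp add: sum_subtractf sum_divide_distrib h'_def b_def add_ac)
    finally show ?thesis .
  qed
  then show ?case by blast
qed

text \<open>The factor t + c completes the numerator to m + 1 factors; paired with the denominator
  they give the product of 1 + c / (t + j), in which every factor decreases in t.\<close>

lemma moment_profile_decreasing: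
  assumes "0 < t" "t < u" "0 < c"
  shows "(u + c) * moment_profile c m u < (t + c) * moment_profile c m t"
proof -
  have q: "(x + c) * moment_profile c m x = (\<Prod>j\<le>m. 1 + c / (x + real j))" if "x > 0" for x
  proof -
    have "(x + c) * moment_profile c m x = pochhammer (x + c) (m + 1) / pochhammer x (m + 1)"
      by (simp add: moment_profile_def pochhammer_rec[of "x + c"])
    also have "\<dots> = (\<Prod>j\<in>{0..<m + 1}. (x + c + real j) / (x + real j))"
      by (simp only: pochhammer_prod prod_dividef)
    also have "\<dots> = (\<Prod>j\<le>m. 1 + c / (x + real j))"
      using that by (intro prod.cong) (auto simp: add_divide_distrib[symmetric] divide_simps)
    finally show ?thesis .
  qed
  have "(\<Prod>j\<le>m. 1 + c / (u + real j)) < (\<Prod>j\<le>m. 1 + c / (t + real j))"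
  proof (rule prod_mono_strict)
    show "0 \<in> {..m}" by simp
    show "1 + c / (u + real 0) < 1 + c / (t + real 0)"
      using assms by (simp add: divide_strict_left_mono)
    show "0 < 1 + c / (t + real j)" for j using assms by (simp add: add_pos_nonneg)
    show "0 \<le> 1 + c / (u + real j) \<and> 1 + c / (u + real j) \<le> 1 + c / (t + real j)" for j
      using assms by (auto intro!: divide_left_mono)
  qed simp
  then show ?thesis using assms by (simp add: q)
qed

section \<open>Consequences of commutation for the profile\<close>

lemma radial_moment_power:
  assumes "N + j = 2 * i"
  shows "radial_moment (\<lambda>r. of_real (r ^ N)) j = 1 / of_nat (i + 1)"
proof -
  have "radial_moment (\<lambda>r. of_real (r ^ N)) j = (\<integral>w. complex_of_real (cmod w ^ (2 * i)) \<partial>dA)"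
    unfolding radial_moment_def by (simp add: power_add[symmetric] assms)
  then show ?thesis by (simp only: integral_dA_cmod_power)
qed

text \<open>Commutation is evaluated on the basis vectors of index s + l and 0. In the first case
  all occurring indices are nonnegative, so the absolute values disappear and the weights of the
  second operator are rational in l. From index 0 the operators lead to -s and p - s, on the other
  side of 0, and this yields an independent equation.\<close>

lemma commuting_radial_profile_zero:
  fixes p s m :: nat and \<phi> :: "real \<Rightarrow> complex"
  assumes ps: "0 < p" "p < s"
    and F: "admissible_symbol (quasihomogeneous (int p) \<phi>)"
    and G: "admissible_symbol (quasihomogeneous (- int s) (\<lambda>r. of_real (r ^ ((2 * m + 1) * s))))"
    and comm: "commute_on_L2h (toeplitz (quasihomogeneous (int p) \<phi>))
           (toeplitz (quasihomogeneous (- int s) (\<lambda>r. of_real (r ^ ((2 * m + 1) * s)))))"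
  shows "AE z in dA. \<phi> (cmod z) = 0"
proof -
  define N where "N = (2 * m + 1) * s"
  define \<psi> where "\<psi> = (\<lambda>r. complex_of_real (r ^ N))"
  define g where "g l = radial_moment \<phi> (p + 2 * l)" for l
  have tF: "toeplitz_coeff (int p) \<phi> (int k) = of_nat (p + k + 1) * g k" for k
  proof -
    have "nat (\<bar>int k\<bar> + \<bar>int p + int k\<bar>) = p + 2 * k" "\<bar>int p + int k\<bar> + 1 = int (p + k + 1)" by auto
    then show ?thesis unfolding toeplitz_coeff_def g_def by (simp only: of_int_of_nat_eq)
  qed
  have tFs: "toeplitz_coeff (int p) \<phi> (- int s) = of_nat (s - p + 1) * g (s - p)"
  proof -
    have "nat (\<bar>- int s\<bar> + \<bar>int p + - int s\<bar>) = p + 2 * (s - p)" using ps by simp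
    moreover have "\<bar>int p + - int s\<bar> + 1 = int (s - p + 1)" using ps by simp
    ultimately show ?thesis unfolding toeplitz_coeff_def g_def by (simp only: of_int_of_nat_eq)
  qed
  have tG: "toeplitz_coeff (- int s) \<psi> (int (s + l)) = of_nat (l + 1) / of_nat ((m + 1) * s + l + 1)" for l
  proof -
    have j: "nat (\<bar>int (s + l)\<bar> + \<bar>- int s + int (s + l)\<bar>) = s + 2 * l"
      and i: "\<bar>- int s + int (s + l)\<bar> + 1 = int (l + 1)" by auto
    \<comment> \<open>An odd multiple of s plus s is an even multiple, so only moments of even order
      occur.\<close>
    have "N + (s + 2 * l) = 2 * ((m + 1) * s + l)" by (simp add: N_def algebra_simps)
    from radial_moment_power[OF this] show ?thesis
      unfolding toeplitz_coeff_def \<psi>_def i j by (simp only: of_int_of_nat_eq times_divide_eq_right mult_1_right)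
  qed
  have tG0: "toeplitz_coeff (- int s) \<psi> (int k) = of_nat (s - k + 1) / of_nat ((m + 1) * s + 1)" if "k \<le> s" for k
  proof -
    have j: "nat (\<bar>int k\<bar> + \<bar>- int s + int k\<bar>) = s"
      and i: "\<bar>- int s + int k\<bar> + 1 = int (s - k + 1)" using that by auto
    have "N + s = 2 * ((m + 1) * s)" by (simp add: N_def algebra_simps)
    from radial_moment_power[OF this] show ?thesis
      unfolding toeplitz_coeff_def \<psi>_def i j by (simp only: of_int_of_nat_eq times_divide_eq_right mult_1_right)
  qed
  have cc: "toeplitz_coeff (- int s) \<psi> k * toeplitz_coeff (int p) \<phi> (- int s + k) =
      toeplitz_coeff (int p) \<phi> k * toeplitz_coeff (- int s) \<psi> (int p + k)" for k
    using commuting_toeplitz_coeff[OF F G comm, of k] by (simp add: \<psi>_def N_def)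
  \<comment> \<open>Clears the denominators b and v together with the factor z that occurs both in a
    weight of the first operator and in a numerator of the second.\<close>
  have cancel: "w * b * y = a * v * x" if "b \<noteq> 0" "v \<noteq> 0" "z \<noteq> 0" "a / b * (z * x) = w * y * (z / v)"
    for a b v w x y z :: complex
  proof -
    have "z * (w * b * y) = b * v * (w * y * (z / v))" using that(2) by simp
    also have "\<dots> = b * v * (a / b * (z * x))" by (simp only: that(4))
    also have "\<dots> = z * (a * v * x)" using that(1) by simp
    finally show ?thesis using that(3) by simp
  qed
  have rec: "of_nat ((l + s + p + 1) * ((m + 1) * s + l + 1)) * g (l + s)
      = of_nat ((l + 1) * (l + 1 + p + (m + 1) * s)) * g l" for l
  proof -
    have 1: "- int s + int (s + l) = int l" "int p + int (s + l) = int (s + (l + p))" by auto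
    have 2: "p + l + 1 = l + p + 1" "p + (l + s) + 1 = l + s + p + 1"
      "(m + 1) * s + (l + p) + 1 = l + 1 + p + (m + 1) * s" "s + l = l + s" by auto
    have "of_nat (l + 1) / of_nat ((m + 1) * s + l + 1) * (of_nat (p + l + 1) * g l) =
        of_nat (p + (s + l) + 1) * g (s + l) * (of_nat (l + p + 1) / of_nat ((m + 1) * s + (l + p) + 1))"
      using cc[of "int (s + l)"] unfolding 1 tG tF .
    from cancel[OF _ _ _ this[unfolded 2]] show ?thesis
      unfolding of_nat_mult of_nat_eq_0_iff by simp
  qed
  \<comment> \<open>Commutation at index 0: s - p + 1 and the denominator (m + 1) s + 1 occur on
    both sides and cancel.\<close>
  have rec0: "of_nat (s + 1) * g (s - p) = of_nat (p + 1) * g 0"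
  proof -
    have "of_nat (s - 0 + 1) / of_nat ((m + 1) * s + 1) * (of_nat (s - p + 1) * g (s - p)) =
      of_nat (p + 0 + 1) * g 0 * (of_nat (s - p + 1) / of_nat ((m + 1) * s + 1))"
      using cc[of "int 0"] ps unfolding tF tG0[OF le0] by (simp only: of_nat_0 add_0_right tFs tG0[OF less_imp_le])
    from cancel[OF _ _ _ this] have "of_nat (p + 1) * of_nat ((m + 1) * s + 1) * g 0
        = of_nat (s + 1) * of_nat ((m + 1) * s + 1) * g (s - p)"
      unfolding of_nat_eq_0_iff by simp
    then have "complex_of_nat ((m + 1) * s + 1) * (of_nat (s + 1) * g (s - p)) =
        of_nat ((m + 1) * s + 1) * (of_nat (p + 1) * g 0)"
      by (simp only: mult_ac)
    moreover have "complex_of_nat ((m + 1) * s + 1) \<noteq> 0" unfolding of_nat_eq_0_iff by simp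
    ultimately show ?thesis by (simp only: mult_cancel_left simp_thms)
  qed
  define c where "c = real p / real s"
  have c: "0 < c" using ps by (simp add: c_def)
  define H where "H l = complex_of_real (moment_profile c m ((real l + 1) / real s))" for l
  have H0: "H l \<noteq> 0" for l
    using moment_profile_pos[of "(real l + 1) / real s" c m] c ps by (simp add: H_def)
  have recH: "of_nat ((l + s + p + 1) * ((m + 1) * s + l + 1)) * H (l + s)
      = of_nat ((l + 1) * (l + 1 + p + (m + 1) * s)) * H l" for l
  proof -
    define t where "t = (real l + 1) / real s"
    have t: "0 < t" using ps by (simp add: t_def)
    have t1: "(real (l + s) + 1) / real s = t + 1" using ps by (simp add: t_def field_simps)
    have e: "real s * t = real l + 1" "real s * c = real p" using ps by (simp_all add: t_def c_def)
    have "real s * (t + 1 + c) * (real s * (t + real m + 1)) * moment_profile c m (t + 1)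
        = real s * real s * ((t + 1 + c) * (t + real m + 1) * moment_profile c m (t + 1))"
      by (simp add: mult_ac)
    also have "\<dots> = real s * real s * (t * (t + c + real m + 1) * moment_profile c m t)"
      using c t by (subst moment_profile_step) auto
    also have "\<dots> = real s * t * (real s * (t + c + real m + 1)) * moment_profile c m t"
      by (simp add: mult_ac)
    finally have "real ((l + s + p + 1) * ((m + 1) * s + l + 1)) * moment_profile c m (t + 1)
        = real ((l + 1) * (l + 1 + p + (m + 1) * s)) * moment_profile c m t"
      by (simp add: distrib_left e) (simp add: algebra_simps)
    from arg_cong[OF this, of complex_of_real] show ?thesis
      unfolding H_def t1 t_def[symmetric] by simp
  qed
  \<comment> \<open>Division is legitimate since H is positive; this constant makes the two
    solutions agree at l = 0, hence along all multiples of s.\<close>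
  define C where "C = g 0 / H 0"
  have gq: "g (q * s) = C * H (q * s)" for q
  proof (induction q)
    case 0 show ?case using H0 by (simp add: C_def)
  next
    case (Suc q)
    define A where "A = complex_of_nat ((q * s + s + p + 1) * ((m + 1) * s + q * s + 1))"
    define B where "B = complex_of_nat ((q * s + 1) * (q * s + 1 + p + (m + 1) * s))"
    have A0: "A \<noteq> 0" unfolding A_def of_nat_eq_0_iff by simp
    have "A * g (q * s + s) = A * (C * H (q * s + s))"
      using rec[of "q * s"] recH[of "q * s"] Suc
      unfolding A_def[symmetric] B_def[symmetric] by (simp add: mult.left_commute[of A C] mult.left_commute[of B C])
    then show ?case using A0 by (simp add: add.commute)
  qed
  obtain h where h: "\<And>t. t > 0 \<Longrightarrow> moment_profile c m t = (\<Sum>j\<le>m. h j / (t + real j))"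
    using moment_profile_partial_fractions[of c m] by blast
  \<comment> \<open>At t = (l + 1) / s the fraction 1 / (t + j) is s / (l + j s + 1), that is, s
    times the integral of |w|^(2 (l + j s)).\<close>
  have Hsum: "H l = (\<Sum>j\<le>m. of_real (h j * real s) / of_nat (l + j * s + 1))" for l
  proof -
    have "moment_profile c m ((real l + 1) / real s) = (\<Sum>j\<le>m. h j / ((real l + 1) / real s + real j))"
      using ps by (intro h) simp
    also have "\<dots> = (\<Sum>j\<le>m. h j * real s / real (l + j * s + 1))"
      using ps by (intro sum.cong) (auto simp: field_simps)
    finally show ?thesis by (simp add: H_def)
  qed
  let ?F = "quasihomogeneous (int p) \<phi>"
  \<comment> \<open>Multiplication by \<open>hpow (- int p)\<close> removes the angular factor, so P
    is radial; it is integrable because that multiplier is bounded. Its even moments are the numbers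
    \<open>g l\<close>.\<close>
  define P where "P w = ?F w * hpow (- int p) w" for w
  have iP: "integrable dA P"
    unfolding P_def using F by (intro integrable_mult_hpow) (simp add: admissible_symbol_def)
  have P: "P w = \<phi> (cmod w) * of_real (cmod w ^ p)" if "w \<in> \<DD>" for w
  proof -
    have "cis (of_int (int p) * Arg w) * cis (of_int (- int p) * Arg w) = 1" by (simp add: cis_mult)
    then show ?thesis
      unfolding P_def quasihomogeneous_def hpow_polar[OF that] by (simp add: mult_ac)
  qed
  have gP: "g l = (\<integral>w. P w * of_real (cmod w ^ (2 * l)) \<partial>dA)" for l
    unfolding g_def radial_moment_def
    by (intro Bochner_Integration.integral_cong) (auto simp: P power_add mult.assoc)
  \<comment> \<open>The polynomial in |w|^(2 s) whose even moments are C H, read off from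
    \<open>Hsum\<close>.\<close>
  define R where "R w = (\<Sum>j\<le>m. C * of_real (h j * real s) * of_real (cmod w ^ (2 * (j * s))))" for w :: complex
  have ip: "integrable dA (\<lambda>w. complex_of_real (cmod w ^ i))" for i
    by (rule integrable_dA_bounded[where B = 1])
      (auto intro!: borel_measurable_dA_continuous continuous_intros simp: norm_power power_le_one)
  have iR: "integrable dA R" unfolding R_def by (intro Bochner_Integration.integrable_sum integrable_mult_right ip)
  have momR: "(\<integral>w. R w * of_real (cmod w ^ (2 * l)) \<partial>dA) = C * H l" for l
  proof -
    have "(\<integral>w. R w * of_real (cmod w ^ (2 * l)) \<partial>dA) =
       (\<integral>w. (\<Sum>j\<le>m. C * of_real (h j * real s) * of_real (cmod w ^ (2 * (l + j * s)))) \<partial>dA)"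
      unfolding R_def sum_distrib_right
      by (intro Bochner_Integration.integral_cong sum.cong refl) (simp add: distrib_left power_add mult_ac)
    also have "\<dots> = (\<Sum>j\<le>m. C * of_real (h j * real s) * (\<integral>w. complex_of_real (cmod w ^ (2 * (l + j * s))) \<partial>dA))"
      by (subst Bochner_Integration.integral_sum) (auto intro!: integrable_mult_right ip simp del: of_real_power)
    also have "\<dots> = C * H l"
      unfolding integral_dA_cmod_power Hsum sum_distrib_left by (simp add: mult.assoc)
    finally show ?thesis .
  qed
  have ae: "AE w in dA. P w - R w = 0"
  proof (rule radial_moments_determine[where s = s])
    fix \<zeta> w :: complex assume "cmod \<zeta> = 1" "w \<in> \<DD>"
    then show "P (\<zeta> * w) - R (\<zeta> * w) = P w - R w" by (simp add: P R_def norm_mult)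
  next
    fix q
    have im: "integrable dA (\<lambda>w. f w * of_real (cmod w ^ i))" if "integrable dA f" for f :: "complex \<Rightarrow> complex" and i
      by (rule integrable_mult_bounded_dA[OF that])
        (auto intro!: continuous_intros simp: norm_power power_le_one)
    have "(\<integral>w. (P w - R w) * of_real (cmod w ^ (2 * s * q)) \<partial>dA)
        = (\<integral>w. P w * of_real (cmod w ^ (2 * (q * s))) - R w * of_real (cmod w ^ (2 * (q * s))) \<partial>dA)"
      by (simp add: left_diff_distrib mult_ac)
    also have "\<dots> = g (q * s) - C * H (q * s)"
      by (subst Bochner_Integration.integral_diff) (auto simp only: im iP iR gP momR)
    finally show "(\<integral>w. (P w - R w) * of_real (cmod w ^ (2 * s * q)) \<partial>dA) = 0" by (simp add: gq)
  qed (use iP iR ps in auto)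
  have gH: "g l = C * H l" for l
  proof -
    have m: "(\<lambda>w. complex_of_real (cmod w ^ (2 * l))) \<in> borel_measurable dA"
      using ip by (rule borel_measurable_integrable)
    have "g l = (\<integral>w. R w * of_real (cmod w ^ (2 * l)) \<partial>dA)"
      unfolding gP
      by (rule integral_cong_AE, rule borel_measurable_times[OF borel_measurable_integrable[OF iP] m],
          rule borel_measurable_times[OF borel_measurable_integrable[OF iR] m])
        (use ae in eventually_elim, simp)
    then show ?thesis by (simp only: momR)
  qed
  have "C = 0"
  proof (rule ccontr)
    assume "C \<noteq> 0"
    have "of_nat (s + 1) * (C * H (s - p)) = of_nat (p + 1) * (C * H 0)"
      using rec0 by (simp only: gH)
    then have "complex_of_nat (s + 1) * H (s - p) = of_nat (p + 1) * H 0"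
      using \<open>C \<noteq> 0\<close> by (simp del: of_nat_Suc of_nat_add)
    then have "complex_of_real (real (s + 1) * moment_profile c m ((real (s - p) + 1) / real s))
        = complex_of_real (real (p + 1) * moment_profile c m (1 / real s))"
      by (simp add: H_def)
    then have eq: "real (s + 1) * moment_profile c m ((real (s - p) + 1) / real s)
        = real (p + 1) * moment_profile c m (1 / real s)"
      unfolding of_real_eq_iff .
    have "((real (s - p) + 1) / real s + c) * moment_profile c m ((real (s - p) + 1) / real s)
        < (1 / real s + c) * moment_profile c m (1 / real s)"
      using ps c by (intro moment_profile_decreasing) (auto simp: divide_strict_right_mono)
    \<comment> \<open>At the two arguments t + c is (s + 1) / s and (p + 1) / s, the weights of
      \<open>rec0\<close> up to the common factor 1 / s.\<close>
    moreover have "(real (s - p) + 1) / real s + c = real (s + 1) / real s" "1 / real s + c = real (p + 1) / real s"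
      using ps by (simp_all add: c_def of_nat_diff add_divide_distrib[symmetric])
    ultimately show False using eq ps by (simp add: divide_less_cancel)
  qed
  \<comment> \<open>With C = 0 the polynomial R vanishes. Away from the origin the factor |w|^p of P
    can then be divided out.\<close>
  then have "AE w in dA. P w = 0" using ae by (simp add: R_def)
  then show ?thesis
    using AE_dA_nonzero AE_space
  proof eventually_elim
    case (elim w)
    then show ?case using P[of w] by simp
  qed
qed

theorem theorem4:
  fixes p s m n :: int and \<phi> :: "real \<Rightarrow> complex"
  assumes "0 < p" and "p < s" and "m \<ge> 0" and "n = (2 * m + 1) * s"
    and "admissible_symbol (quasihomogeneous p \<phi>)"
    and "admissible_symbol (quasihomogeneous (- s) (\<lambda>r. of_real (r powi n)))"
    and "commute_on_L2h (toeplitz (quasihomogeneous p \<phi>))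
           (toeplitz (quasihomogeneous (- s) (\<lambda>r. of_real (r powi n))))"
  shows "(\<not> (AE z in dA. \<phi> (cmod z) = 0) \<longrightarrow> p = 1) \<and>
         (s \<le> m + 1 \<longrightarrow>
            (\<exists>c :: int \<Rightarrow> complex.
               AE z in dA. \<phi> (cmod z) = (\<Sum>j = 0..m. c j * of_real (cmod z powi (2 * j - 1))))) \<and>
         (s > m + 1 \<longrightarrow> (AE z in dA. \<phi> (cmod z) = 0))"
proof -
  have n: "n = int ((2 * nat m + 1) * nat s)" using assms(1-4) by (simp add: algebra_simps)
  have pw: "(\<lambda>r::real. complex_of_real (r powi n)) = (\<lambda>r. of_real (r ^ ((2 * nat m + 1) * nat s)))"
    unfolding n power_int_of_nat ..
  have "AE z in dA. \<phi> (cmod z) = 0"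
    by (rule commuting_radial_profile_zero[of "nat p" "nat s" \<phi> "nat m"])
      (use assms in \<open>simp_all only: pw[symmetric]\<close>, use assms in simp_all)
  \<comment> \<open>The zero profile is the required combination with all constants 0.\<close>
  moreover from this have "\<exists>c :: int \<Rightarrow> complex.
      AE z in dA. \<phi> (cmod z) = (\<Sum>j = 0..m. c j * of_real (cmod z powi (2 * j - 1)))"
    by (intro exI[of _ "\<lambda>_. 0"]) simp
  ultimately show ?thesis by blast
qed

end
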